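(* Let $H$ be a strongly primary (commutative) monoid that is not half-factorial. \begin{enumerate} \item There is a $\beta \in \mathbb{Q}_{>1}$ such that $\rho(L) \ge \beta$ for all $L \in \mathcal{L}(H)$ with $\rho(L) \ne 1$. \item $\mathcal{L}(H) \ne \mathcal{L}(G_0)$ for any subset $G_0$ of any abelian group. In particular, $H$ is not a transfer Krull monoid. \item If one of the following two conditions holds, then $H$ is locally tame: \begin{itemize} \item $\sup\{ \min \mathsf{L}(c) \mid c \in H \} < \infty$. \item There exists some $u \in H \setminus H^\times$ such that $\rho_{\mathcal{M}(u)}(H) < \infty$. \end{itemize} If $H$ is locally tame, then $\Delta(H)$ is finite, and there is an $M \in \mathbb{N}_0$ such that every $L \in \mathcal{L}(H)$ is an AAMP with period $\{0, \min \Delta(H)\}$ and bound $M$. \end{enumerate}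
   Context: $\mathbb{N}$ is the set of positive integers, $\mathbb{N}_0 = \mathbb{N} \cup \{0\}$, and $[a,b] = \{x \in \mathbb{Z} \mid a \le x \le b\}$. A monoid is a commutative cancellative semigroup with unit element, written multiplicatively; $H^\times$ is its group of units, $\mathfrak{m} = H \setminus H^\times$, and $H_{\mathrm{red}} = H/H^\times$. An atom is a nonunit $a$ such that $a = uv$ implies $u \in H^\times$ or $v \in H^\times$; $\mathcal{A}(H)$ is the set of atoms; $H$ is atomic if every nonunit is a finite product of atoms. For a nonunit $a$, $\mathsf{L}(a)$ is the set of $k \in \mathbb{N}$ such that $a$ is a product of $k$ atoms, and $\mathsf{L}(a) = \{0\}$ for $a \in H^\times$. $\mathcal{L}(H) = \{\mathsf{L}(a) \mid a \in H\}$. $H$ is half-factorial if $|L| = 1$ for all $L \in \mathcal{L}(H)$. For $L \subset \mathbb{N}$, $\rho(L) = \sup L/\min L$, and $\rho(\{0\}) = 1$. For $k \in \mathbb{N}$ and $H \neq H^\times$, $\rho_k(H) = \sup\{\sup L \mid k \in L \in \mathcal{L}(H)\}$. A distance of $L$ is a $d \in \mathbb{N}$ such that there are $a, b \in L$ with $b - a = d$ and $[a,b] \cap L = \{a,b\}$; $\Delta(L)$ is the set of distances of $L$ and $\Delta(H) = \bigcup_{L \in \mathcal{L}(H)} \Delta(L)$. $H$ is strongly primary if $\mathfrak{m} \ne \emptyset$ and for every $a \in \mathfrak{m}$ there is an $n \in \mathbb{N}$ with $\mathfrak{m}^n \subset aH$, where $\mathfrak m^n$ is the set of products of $n$ elements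 of $\mathfrak m$; the smallest such $n$ is denoted $\mathcal{M}(a)$. (Strongly primary monoids are atomic with finite sets of lengths.) Locally tame: let $H$ be atomic and let $\mathsf{Z}(H)$ be the free abelian monoid with basis $\mathcal{A}(H_{\mathrm{red}})$; for $a \in H$ let $\mathsf{Z}(a) \subset \mathsf{Z}(H)$ be the set of formal products whose value in $H_{\mathrm{red}}$ is $aH^\times$. For $z, z' \in \mathsf{Z}(H)$ with $w = \gcd(z,z')$, put $\mathsf{d}(z,z') = \max\{|w^{-1}z|, |w^{-1}z'|\}$, where $|\cdot|$ is the length. For $u \in \mathcal{A}(H_{\mathrm{red}})$, let $\mathsf{t}(H,u)$ be the smallest $N \in \mathbb{N}_0 \cup \{\infty\}$ such that for all $a \in H$ with $\mathsf{Z}(a) \cap u\mathsf{Z}(H) \ne \emptyset$ and all $z \in \mathsf{Z}(a)$ there is $z' \in \mathsf{Z}(a) \cap u\mathsf{Z}(H)$ with $\mathsf{d}(z,z') \le N$. $H$ is locally tame if $\mathsf{t}(H,u) < \infty$ for all $u \in \mathcal{A}(H_{\mathrm{red}})$. AAMP: let $d \in \mathbb{N}$, $M \in \mathbb{N}_0$ and $\{0,d\} \subset \mathcal{D} \subset [0,d]$. A set $L \subset \mathbb{Z}$ is an almost arithmetical multiprogression (AAMP) with difference $d$, period $\mathcal{D}$ and bound $M$ if $L = y + (L' \cup L^* \cup L'') \subset y + \mathcal{D} + d\mathbb{Z}$ for some $y \in \mathbb{Z}$, where $L^*$ is finite nonempty with $\min L^* = 0$ and $L^* = (\mathcal{D}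 + d\mathbb{Z}) \cap [0, \max L^*]$, $L' \subset [-M,-1]$ and $L'' \subset \max L^* + [1,M]$. Zero-sum sequences: for a subset $G_0$ of an additive abelian group, $\mathcal{F}(G_0)$ is the (multiplicatively written) free abelian monoid with basis $G_0$, $\mathcal{B}(G_0) = \{g_1 \cdots g_\ell \in \mathcal{F}(G_0) \mid g_1 + \dots + g_\ell = 0\}$, and $\mathcal{L}(G_0) = \mathcal{L}(\mathcal{B}(G_0))$. A monoid homomorphism $\theta \colon H \to \mathcal{B}(G_0)$ is a weak transfer homomorphism if it is surjective, $\theta^{-1}(1) = H^\times$, and whenever $a \in H$, $n \in \mathbb{N}$, $v_1, \dots, v_n \in \mathcal{A}(\mathcal{B}(G_0))$ with $\theta(a) = v_1 \cdots v_n$, there exist $u_1, \dots, u_n \in \mathcal{A}(H)$ and a permutation $\tau$ of $[1,n]$ with $a = u_1 \cdots u_n$ and $\theta(u_i) = v_{\tau(i)}$ for all $i$. $H$ is a transfer Krull monoid if such a $\theta$ exists for some subset $G_0$ of an abelian group. *)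

theory Defs
  imports "HOL-Algebra.Divisibility" "HOL-Algebra.FiniteProduct"
    "HOL-Combinatorics.Permutations" "HOL-Library.Multiset" "HOL-Library.Extended_Real"
begin

section \<open>Nonunits, atoms and sets of lengths\<close>

definition nonunits :: "('a, 'b) monoid_scheme \<Rightarrow> 'a set" where
  "nonunits H = carrier H - Units H"

definition atoms :: "('a, 'b) monoid_scheme \<Rightarrow> 'a set" where
  "atoms H = {a \<in> carrier H. irreducible H a}"

text \<open>The library's irreducibility speaks about proper factors. In a cancellative commutative
  monoid it is the condition that in \<open>a = u v\<close> one of the factors is a unit.\<close>

lemma atoms_iff:
  assumes "comm_monoid_cancel H"
  shows "a \<in> atoms H \<longleftrightarrow> a \<in> nonunits H \<and>
    (\<forall>u\<in>carrier H. \<forall>v\<in>carrier H. a = u \<otimes>\<^bsub>H\<^esub> v \<longrightarrow> u \<in> Units H \<or> v \<in> Units H)"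
proof -
  interpret comm_monoid_cancel H by fact
  show ?thesis
  proof (intro iffI conjI ballI impI)
    assume a: "a \<in> atoms H"
    then show "a \<in> nonunits H"
      by (auto simp: atoms_def nonunits_def irreducible_def)
    fix u v assume u: "u \<in> carrier H" and v: "v \<in> carrier H" and e: "a = u \<otimes>\<^bsub>H\<^esub> v"
    show "u \<in> Units H \<or> v \<in> Units H"
      using a u v e irreducible_prodE[of u v] by (auto simp: atoms_def)
  next
    assume a: "a \<in> nonunits H \<and>
      (\<forall>u\<in>carrier H. \<forall>v\<in>carrier H. a = u \<otimes>\<^bsub>H\<^esub> v \<longrightarrow> u \<in> Units H \<or> v \<in> Units H)"
    have "b \<in> Units H" if b: "b \<in> carrier H" and p: "properfactor H b a" for b
    proof -
      from p obtain c where c: "c \<in> carrier H" "a = b \<otimes>\<^bsub>H\<^esub> c"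
        by (auto simp: properfactor_def factor_def)
      have "b = a \<otimes>\<^bsub>H\<^esub> inv\<^bsub>H\<^esub> c" if "c \<in> Units H"
        using that b c by (simp add: m_assoc)
      then have "c \<notin> Units H"
        using p by (auto simp: properfactor_def factor_def)
      then show ?thesis using a b c by blast
    qed
    then show "a \<in> atoms H"
      using a by (auto simp: atoms_def nonunits_def irreducible_def)
  qed
qed

definition lengths :: "('a, 'b) monoid_scheme \<Rightarrow> 'a \<Rightarrow> nat set" where
  "lengths H a =
    (if a \<in> Units H then {0}
     else {length as | as. as \<noteq> [] \<and> set as \<subseteq> carrier H \<and> factors H as a})"

definition sets_of_lengths :: "('a, 'b) monoid_scheme \<Rightarrow> nat set set" where
  "sets_of_lengths H = lengths H ` carrier H"

definition atomic_monoid :: "('a, 'b) monoid_scheme \<Rightarrow> bool" where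
  "atomic_monoid H \<longleftrightarrow>
    (\<forall>a\<in>nonunits H. \<exists>as. set as \<subseteq> carrier H \<and> factors H as a)"

definition half_factorial :: "('a, 'b) monoid_scheme \<Rightarrow> bool" where
  "half_factorial H \<longleftrightarrow> (\<forall>L\<in>sets_of_lengths H. card L = 1)"

definition rho :: "nat set \<Rightarrow> ereal" where
  "rho L = (if L = {0} then 1 else ereal_of_enat (SUP l\<in>L. enat l) / ereal (real (Inf L)))"

definition rho_k :: "('a, 'b) monoid_scheme \<Rightarrow> nat \<Rightarrow> enat" where
  "rho_k H k = (SUP L\<in>{L \<in> sets_of_lengths H. k \<in> L}. SUP l\<in>L. enat l)"

definition distances :: "nat set \<Rightarrow> nat set" where
  "distances L = {d. d \<ge> 1 \<and> (\<exists>a\<in>L. \<exists>b\<in>L. b = a + d \<and> {a..b} \<inter> L = {a, b})}"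

definition Delta :: "('a, 'b) monoid_scheme \<Rightarrow> nat set" where
  "Delta H = (\<Union>L\<in>sets_of_lengths H. distances L)"

section \<open>Strongly primary monoids\<close>

definition nonunit_power :: "('a, 'b) monoid_scheme \<Rightarrow> nat \<Rightarrow> 'a set" where
  "nonunit_power H n =
    {foldr (\<otimes>\<^bsub>H\<^esub>) xs \<one>\<^bsub>H\<^esub> | xs. length xs = n \<and> set xs \<subseteq> nonunits H}"

definition strongly_primary :: "('a, 'b) monoid_scheme \<Rightarrow> bool" where
  "strongly_primary H \<longleftrightarrow> nonunits H \<noteq> {} \<and>
    (\<forall>a\<in>nonunits H. \<exists>n\<ge>1. nonunit_power H n \<subseteq> a <#\<^bsub>H\<^esub> carrier H)"

definition primary_exponent :: "('a, 'b) monoid_scheme \<Rightarrow> 'a \<Rightarrow> nat" where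
  "primary_exponent H a = (LEAST n. n \<ge> 1 \<and> nonunit_power H n \<subseteq> a <#\<^bsub>H\<^esub> carrier H)"

section \<open>Factorizations and local tameness\<close>

text \<open>Free abelian monoids are rendered by finite multisets, so a formal product is a multiset
  and its value in a commutative monoid is the following product.\<close>

definition mset_prod :: "('a, 'b) monoid_scheme \<Rightarrow> 'a multiset \<Rightarrow> 'a" where
  "mset_prod K S = finprod K (\<lambda>g. g [^]\<^bsub>K\<^esub> count S g) (set_mset S)"

lemma mset_prod_superset:
  assumes "comm_monoid K" "set_mset S \<subseteq> A" "finite A" "A \<subseteq> carrier K"
  shows "mset_prod K S = finprod K (\<lambda>g. g [^]\<^bsub>K\<^esub> count S g) A"
proof -
  interpret comm_monoid K by fact
  have "finprod K (\<lambda>g. g [^]\<^bsub>K\<^esub> count S g) A = finprod K (\<lambda>g. g [^]\<^bsub>K\<^esub> count S g) (set_mset S)"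
    using assms by (intro finprod_mono_neutral_cong_left[symmetric]) (auto simp: not_in_iff)
  then show ?thesis by (simp add: mset_prod_def)
qed

lemma mset_prod_union:
  assumes "comm_monoid K" "set_mset S \<subseteq> carrier K" "set_mset T \<subseteq> carrier K"
  shows "mset_prod K (S + T) = mset_prod K S \<otimes>\<^bsub>K\<^esub> mset_prod K T"
proof -
  interpret comm_monoid K by fact
  let ?A = "set_mset S \<union> set_mset T"
  have A: "?A \<subseteq> carrier K" "finite ?A" using assms by auto
  have "mset_prod K (S + T) = finprod K (\<lambda>g. g [^]\<^bsub>K\<^esub> count (S + T) g) ?A"
    using A by (intro mset_prod_superset) (auto intro: comm_monoid_axioms)
  also have "\<dots> = finprod K (\<lambda>g. g [^]\<^bsub>K\<^esub> count S g \<otimes>\<^bsub>K\<^esub> g [^]\<^bsub>K\<^esub> count T g) ?A"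
    using A by (intro finprod_cong') (auto simp: nat_pow_mult subset_eq)
  also have "\<dots> = finprod K (\<lambda>g. g [^]\<^bsub>K\<^esub> count S g) ?A \<otimes>\<^bsub>K\<^esub> finprod K (\<lambda>g. g [^]\<^bsub>K\<^esub> count T g) ?A"
    using A by (intro finprod_multf) auto
  also have "\<dots> = mset_prod K S \<otimes>\<^bsub>K\<^esub> mset_prod K T"
    using A mset_prod_superset[OF comm_monoid_axioms, of S ?A]
      mset_prod_superset[OF comm_monoid_axioms, of T ?A] by simp
  finally show ?thesis .
qed

lemma mset_prod_mset:
  assumes "comm_monoid K" "set xs \<subseteq> carrier K"
  shows "mset_prod K (mset xs) = foldr (\<otimes>\<^bsub>K\<^esub>) xs \<one>\<^bsub>K\<^esub>"
  using assms(2)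
proof (induction xs)
  interpret comm_monoid K by fact
  case Nil
  then show ?case by (simp add: mset_prod_def)
next
  interpret comm_monoid K by fact
  case (Cons x xs)
  have "mset_prod K {#x#} = x"
    using Cons.prems by (simp add: mset_prod_def)
  then show ?case
    using mset_prod_union[OF assms(1), of "{#x#}" "mset xs"] Cons by simp
qed

definition reduced :: "('a, 'b) monoid_scheme \<Rightarrow> 'a set monoid" where
  "reduced H = H Mod Units H"

definition Fact :: "('a, 'b) monoid_scheme \<Rightarrow> 'a set multiset set" where
  "Fact H = {z. set_mset z \<subseteq> atoms (reduced H)}"

definition fact_of :: "('a, 'b) monoid_scheme \<Rightarrow> 'a \<Rightarrow> 'a set multiset set" where
  "fact_of H a = {z \<in> Fact H. mset_prod (reduced H) z = Units H #>\<^bsub>H\<^esub> a}"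

definition fact_mult :: "('a, 'b) monoid_scheme \<Rightarrow> 'a set \<Rightarrow> 'a set multiset set" where
  "fact_mult H u = {add_mset u z | z. z \<in> Fact H}"

text \<open>The multiset intersection is the greatest common divisor in a free abelian monoid.\<close>

definition fact_dist :: "'c multiset \<Rightarrow> 'c multiset \<Rightarrow> nat" where
  "fact_dist z z' = (let w = z \<inter># z' in max (size (z - w)) (size (z' - w)))"

definition tame_degree :: "('a, 'b) monoid_scheme \<Rightarrow> 'a set \<Rightarrow> enat" where
  "tame_degree H u = (LEAST N. \<forall>a\<in>carrier H. fact_of H a \<inter> fact_mult H u \<noteq> {} \<longrightarrow>
    (\<forall>z\<in>fact_of H a. \<exists>z'\<in>fact_of H a \<inter> fact_mult H u. enat (fact_dist z z') \<le> N))"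

definition locally_tame :: "('a, 'b) monoid_scheme \<Rightarrow> bool" where
  "locally_tame H \<longleftrightarrow> atomic_monoid H \<and> (\<forall>u\<in>atoms (reduced H). tame_degree H u < \<infinity>)"

section \<open>Almost arithmetical multiprogressions\<close>

definition AAMP :: "int \<Rightarrow> int set \<Rightarrow> nat \<Rightarrow> int set \<Rightarrow> bool" where
  "AAMP d D M L \<longleftrightarrow> d \<ge> 1 \<and> {0, d} \<subseteq> D \<and> D \<subseteq> {0..d} \<and>
    (let P = {x + d * k | x k. x \<in> D} in
     \<exists>y L' Ls L''.
       L = (+) y ` (L' \<union> Ls \<union> L'') \<and> L \<subseteq> (+) y ` P \<and>
       finite Ls \<and> Ls \<noteq> {} \<and> Min Ls = 0 \<and> Ls = P \<inter> {0..Max Ls} \<and>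
       L' \<subseteq> {- int M..- 1} \<and> L'' \<subseteq> {Max Ls + 1..Max Ls + int M})"

section \<open>Zero-sum sequences and transfer Krull monoids\<close>

text \<open>The abelian group \<open>K\<close> is written multiplicatively, as groups are in the library, so
  zero-sum means that the product of the terms is \<open>\<one>\<close>.\<close>

definition zero_sum_monoid :: "('g, 'm) monoid_scheme \<Rightarrow> 'g set \<Rightarrow> 'g multiset monoid" where
  "zero_sum_monoid K G\<^sub>0 =
    \<lparr>carrier = {S. set_mset S \<subseteq> G\<^sub>0 \<and> mset_prod K S = \<one>\<^bsub>K\<^esub>}, mult = (+), one = {#}\<rparr>"

definition weak_transfer_hom ::
  "('a, 'b) monoid_scheme \<Rightarrow> ('c, 'd) monoid_scheme \<Rightarrow> ('a \<Rightarrow> 'c) \<Rightarrow> bool" where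
  "weak_transfer_hom H B \<theta> \<longleftrightarrow>
    \<theta> \<in> hom H B \<and> \<theta> \<one>\<^bsub>H\<^esub> = \<one>\<^bsub>B\<^esub> \<and>
    \<theta> ` carrier H = carrier B \<and>
    {a \<in> carrier H. \<theta> a = \<one>\<^bsub>B\<^esub>} = Units H \<and>
    (\<forall>a\<in>carrier H. \<forall>vs. vs \<noteq> [] \<and> set vs \<subseteq> carrier B \<and> factors B vs (\<theta> a) \<longrightarrow>
      (\<exists>us \<tau>. length us = length vs \<and> set us \<subseteq> carrier H \<and> factors H us a \<and>
        \<tau> permutes {..<length vs} \<and> (\<forall>i<length vs. \<theta> (us ! i) = vs ! \<tau> i)))"

text \<open>The existential over abelian groups ranges over groups with elements in \<open>'g\<close>. A
  statement about all abelian groups is obtained by leaving \<open>'g\<close> a free type variable.\<close>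

definition transfer_Krull :: "'g itself \<Rightarrow> ('a, 'b) monoid_scheme \<Rightarrow> bool" where
  "transfer_Krull _ H \<longleftrightarrow>
    (\<exists>(K :: 'g monoid) G\<^sub>0 \<theta>. comm_group K \<and> G\<^sub>0 \<subseteq> carrier K \<and>
      weak_transfer_hom H (zero_sum_monoid K G\<^sub>0) \<theta>)"

end

theory Submission
  imports Defs
begin

text \<open>Fix a nonunit \<open>a\<close>. In a strongly primary monoid every product of at least \<open>primary_exponent G a\<close>
  atoms is divisible by \<open>a\<close>, so every \<open>b\<close> is \<open>a [^] q \<otimes> c\<close> with \<open>c\<close> having only short
  factorizations. Taking \<open>a\<close> with two different lengths, these lengths are inherited by all large
  elements: elasticities stay away from \<open>1\<close>, and only finitely many sets of lengths are singletons.
  In contrast, an atom \<open>U\<close> of minimal support among the zero-sum sequences over \<open>G\<^sub>0\<close> is the only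
  atom over its support, so \<open>U\<^sup>k\<close> has the set of lengths \<open>{k}\<close> for every \<open>k\<close>. Taking for \<open>a\<close> a large power
  of an element with lengths \<open>m\<close> and \<open>m + min \<Delta>\<close> gives the structure of sets of lengths.\<close>

section \<open>Factorizations in the reduced monoid\<close>

text \<open>Divisibility of long products by \<open>a\<close> puts every translate of
  \<open>lengths G c\<close> by a length of \<open>a\<close> inside
  \<open>lengths G (a \<otimes> c)\<close>, but it does not limit how far the other lengths of
  \<open>a \<otimes> c\<close> stray from these translates. This is the obstacle that local tameness
  removes: for a fixed length \<open>m\<close> of \<open>a\<close>, every length of
  \<open>a \<otimes> c\<close> lies within a constant, independent of \<open>c\<close>, of some
  \<open>m + l\<close> with \<open>l\<close> a length of \<open>c\<close>. Nothing else is drawn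
  from tameness, and both the bound on the gaps and the short ends of sets of lengths come from it.
  Conversely, tameness at an atom \<open>x\<close> only requires the shortest factorization of
  \<open>c\<close> to stay bounded when \<open>x \<otimes> c\<close> has a factorization into few
  atoms. The first sufficient condition bounds it outright. The second one bounds all lengths of an
  element in terms of any one of them, because a product of few atoms cannot be divisible by a high
  power of \<open>u\<close>.\<close>

context comm_monoid_cancel
begin

abbreviation unit_class :: "'a \<Rightarrow> 'a set" where
  "unit_class a \<equiv> Units G #> a"

abbreviation mprod :: "'a list \<Rightarrow> 'a" where
  "mprod xs \<equiv> foldr (\<otimes>) xs \<one>"

lemma mprod_append:
  assumes "set xs \<subseteq> carrier G" "set ys \<subseteq> carrier G"
  shows "mprod (xs @ ys) = mprod xs \<otimes> mprod ys"
  using assms(1)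
proof (induction xs)
  case Nil
  then show ?case using assms(2) by simp
next
  case (Cons x xs)
  then show ?case using assms(2) by (simp add: m_assoc)
qed

lemma mem_unit_class: "a \<in> carrier G \<Longrightarrow> a \<in> unit_class a"
  by (force simp: r_coset_def)

lemma unit_class_eq_iff:
  assumes "a \<in> carrier G" "b \<in> carrier G"
  shows "unit_class a = unit_class b \<longleftrightarrow> (\<exists>e\<in>Units G. a = e \<otimes> b)"
proof
  assume "unit_class a = unit_class b"
  then have "a \<in> unit_class b" using mem_unit_class[OF assms(1)] by simp
  then show "\<exists>e\<in>Units G. a = e \<otimes> b" by (auto simp: r_coset_def)
next
  assume "\<exists>e\<in>Units G. a = e \<otimes> b"
  then obtain e where e: "e \<in> Units G" "a = e \<otimes> b" by blast
  have "x \<otimes> b \<in> unit_class a" if "x \<in> Units G" for x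
  proof -
    have "x \<otimes> b = x \<otimes> (inv e \<otimes> e) \<otimes> b" using e that assms by (simp add: Units_closed)
    also have "\<dots> = (x \<otimes> inv e) \<otimes> a"
      using e that assms by (simp only: m_assoc Units_closed Units_inv_closed m_closed)
    finally have "x \<otimes> b = (x \<otimes> inv e) \<otimes> a" .
    moreover have "x \<otimes> inv e \<in> Units G" using e that by simp
    ultimately show ?thesis unfolding r_coset_def by blast
  qed
  moreover have "x \<otimes> a \<in> unit_class b" if "x \<in> Units G" for x
  proof -
    have "x \<otimes> a = (x \<otimes> e) \<otimes> b" using e that assms by (simp add: m_assoc Units_closed)
    moreover have "x \<otimes> e \<in> Units G" using e that by simp
    ultimately show ?thesis unfolding r_coset_def by blast
  qed
  ultimately show "unit_class a = unit_class b"
    unfolding r_coset_def by blast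
qed

lemma unit_class_mult:
  assumes "a \<in> carrier G" "b \<in> carrier G"
  shows "unit_class a <#> unit_class b = unit_class (a \<otimes> b)"
proof -
  have "e \<otimes> a \<otimes> (f \<otimes> b) \<in> unit_class (a \<otimes> b)" if "e \<in> Units G" "f \<in> Units G" for e f
  proof -
    have "e \<otimes> a \<otimes> (f \<otimes> b) = (e \<otimes> f) \<otimes> (a \<otimes> b)"
      using assms that by (simp add: Units_closed m_ac)
    then show ?thesis using that by (auto simp: r_coset_def)
  qed
  moreover have "e \<otimes> (a \<otimes> b) \<in> unit_class a <#> unit_class b" if "e \<in> Units G" for e
  proof -
    have "e \<otimes> (a \<otimes> b) = (e \<otimes> a) \<otimes> (\<one> \<otimes> b)"
      using assms that by (simp add: Units_closed m_ac)
    then show ?thesis using that unfolding set_mult_def r_coset_def by blast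
  qed
  ultimately show ?thesis unfolding set_mult_def r_coset_def by blast
qed

lemma unit_class_one: "unit_class \<one> = Units G"
  by (auto simp: r_coset_def Units_closed)

lemma carrier_reduced: "carrier (reduced G) = unit_class ` carrier G"
  by (simp add: reduced_def carrier_FactGroup)

lemma one_reduced: "\<one>\<^bsub>reduced G\<^esub> = unit_class \<one>"
  by (simp add: reduced_def unit_class_one)

lemma mult_reduced:
  "a \<in> carrier G \<Longrightarrow> b \<in> carrier G \<Longrightarrow>
    unit_class a \<otimes>\<^bsub>reduced G\<^esub> unit_class b = unit_class (a \<otimes> b)"
  by (simp add: reduced_def unit_class_mult)

lemma comm_monoid_reduced: "comm_monoid (reduced G)"
  by unfold_locales (auto simp: carrier_reduced one_reduced mult_reduced m_ac)

lemma Units_reduced_iff: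
  assumes a: "a \<in> carrier G"
  shows "unit_class a \<in> Units (reduced G) \<longleftrightarrow> a \<in> Units G"
proof
  assume "unit_class a \<in> Units (reduced G)"
  then obtain b where b: "b \<in> carrier G" "unit_class (a \<otimes> b) = unit_class \<one>"
    using a by (auto simp: Units_def[of "reduced G"] carrier_reduced one_reduced mult_reduced)
  then have "a \<otimes> b \<in> Units G"
    using a by (auto simp: unit_class_eq_iff Units_closed)
  then show "a \<in> Units G" using a b unit_factor by blast
next
  assume "a \<in> Units G"
  then show "unit_class a \<in> Units (reduced G)"
    using a unfolding Units_def[of "reduced G"]
    by (auto simp: carrier_reduced one_reduced mult_reduced intro!: bexI[of _ "inv a"])
qed

lemma divides_reduced_iff:
  assumes a: "a \<in> carrier G" and b: "b \<in> carrier G"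
  shows "unit_class a divides\<^bsub>reduced G\<^esub> unit_class b \<longleftrightarrow> a divides b"
proof
  assume "unit_class a divides\<^bsub>reduced G\<^esub> unit_class b"
  then obtain c where c: "c \<in> carrier G" "unit_class b = unit_class (a \<otimes> c)"
    using a by (auto simp: factor_def carrier_reduced mult_reduced)
  then obtain e where e: "e \<in> Units G" "b = e \<otimes> (a \<otimes> c)"
    using a b by (auto simp: unit_class_eq_iff)
  then have "b = a \<otimes> (e \<otimes> c)" using a c by (simp add: Units_closed m_ac)
  then show "a divides b" using c e by (auto simp: factor_def Units_closed)
next
  assume "a divides b"
  then show "unit_class a divides\<^bsub>reduced G\<^esub> unit_class b"
    using a by (force simp: factor_def carrier_reduced mult_reduced)
qed

text \<open>Irreducibility is defined by units and divisibility alone, and both can be tested on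
  representatives.\<close>

lemma atoms_reduced: "atoms (reduced G) = unit_class ` atoms G"
  by (auto simp: atoms_def irreducible_def properfactor_def carrier_reduced
      Units_reduced_iff divides_reduced_iff)

lemma atoms_closed: "x \<in> atoms G \<Longrightarrow> x \<in> carrier G"
  by (simp add: atoms_def)

lemma mset_prod_reduced:
  assumes "set xs \<subseteq> carrier G"
  shows "mset_prod (reduced G) (mset (map unit_class xs)) = unit_class (mprod xs)"
proof -
  have "set (map unit_class xs) \<subseteq> carrier (reduced G)"
    using assms by (auto simp: carrier_reduced)
  then have "mset_prod (reduced G) (mset (map unit_class xs)) =
      foldr (\<otimes>\<^bsub>reduced G\<^esub>) (map unit_class xs) \<one>\<^bsub>reduced G\<^esub>"
    by (intro mset_prod_mset comm_monoid_reduced) auto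
  also have "\<dots> = unit_class (mprod xs)"
    using assms by (induction xs) (auto simp: one_reduced mult_reduced)
  finally show ?thesis .
qed

lemma Fact_listE:
  assumes "z \<in> Fact G"
  obtains xs where "set xs \<subseteq> atoms G" "z = mset (map unit_class xs)"
proof -
  obtain ys where ys: "z = mset ys" using ex_mset by metis
  then have "ys \<in> lists (unit_class ` atoms G)"
    using assms by (auto simp: Fact_def atoms_reduced)
  then obtain xs where "ys = map unit_class xs" "xs \<in> lists (atoms G)"
    unfolding lists_image by blast
  then show thesis using ys that by blast
qed

lemma Fact_valueE:
  assumes "z \<in> Fact G"
  obtains c where "c \<in> carrier G" "z \<in> fact_of G c"
proof -
  obtain xs where xs: "set xs \<subseteq> atoms G" "z = mset (map unit_class xs)"
    using assms by (rule Fact_listE)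
  then have "set xs \<subseteq> carrier G" by (auto dest: atoms_closed)
  then show thesis using xs mset_prod_reduced[of xs] assms that[of "mprod xs"]
    by (auto simp: fact_of_def)
qed

lemma Fact_carrier: "z \<in> Fact G \<Longrightarrow> set_mset z \<subseteq> carrier (reduced G)"
  by (auto simp: Fact_def atoms_def)

lemma Fact_union: "y + z \<in> Fact G \<longleftrightarrow> y \<in> Fact G \<and> z \<in> Fact G"
  by (auto simp: Fact_def)

lemma fact_of_union:
  assumes "a \<in> carrier G" "b \<in> carrier G" "y \<in> fact_of G a" "z \<in> fact_of G b"
  shows "y + z \<in> fact_of G (a \<otimes> b)"
  using assms mset_prod_union[OF comm_monoid_reduced, of y z] Fact_carrier
  by (auto simp: fact_of_def Fact_union mult_reduced)

text \<open>Units are absorbed by the last factor, so the splitting is exact although factorizations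
  live in the reduced monoid.\<close>

lemma fact_of_unionE:
  assumes a: "a \<in> carrier G" and b: "b \<in> carrier G"
    and y: "y \<in> fact_of G b" and yz: "y + z \<in> fact_of G a"
  obtains c where "c \<in> carrier G" "z \<in> fact_of G c" "a = b \<otimes> c"
proof -
  have "z \<in> Fact G" using yz by (auto simp: fact_of_def Fact_union)
  then obtain c where c: "c \<in> carrier G" "z \<in> fact_of G c"
    by (rule Fact_valueE)
  then have "y + z \<in> fact_of G (b \<otimes> c)" using fact_of_union b y by blast
  then have "unit_class a = unit_class (b \<otimes> c)" using yz by (simp add: fact_of_def)
  then obtain e where e: "e \<in> Units G" "a = e \<otimes> (b \<otimes> c)"
    using a b c by (auto simp: unit_class_eq_iff)
  have ac: "a = b \<otimes> (e \<otimes> c)" using e b c by (simp add: Units_closed m_ac)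
  have "unit_class (e \<otimes> c) = unit_class c"
    using e c by (subst unit_class_eq_iff) (auto simp: Units_closed)
  then show thesis using that[of "e \<otimes> c"] ac e c by (simp add: fact_of_def Units_closed)
qed

lemma fact_of_atom:
  assumes "x \<in> atoms G"
  shows "{#unit_class x#} \<in> fact_of G x"
  using assms mset_prod_reduced[of "[x]"] atoms_closed[OF assms]
  by (auto simp: fact_of_def Fact_def atoms_reduced)

lemma fact_of_unit:
  assumes "a \<in> Units G"
  shows "fact_of G a = {{#}}"
proof -
  have "{#} \<in> fact_of G a"
    using assms mset_prod_reduced[of "[]"]
    by (auto simp: fact_of_def Fact_def unit_class_eq_iff Units_closed intro!: bexI[of _ "inv a"])
  moreover have "z = {#}" if z: "z \<in> fact_of G a" for z
  proof (rule ccontr)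
    assume "z \<noteq> {#}"
    moreover have "z \<in> Fact G" using z by (simp add: fact_of_def)
    then obtain xs where xs: "set xs \<subseteq> atoms G" "z = mset (map unit_class xs)"
      by (rule Fact_listE)
    ultimately obtain x ys where s: "xs = x # ys" by (cases xs) auto
    have c: "set xs \<subseteq> carrier G" using xs atoms_closed by auto
    then have "unit_class (mprod xs) = unit_class a"
      using mset_prod_reduced z xs by (simp add: fact_of_def)
    then obtain e where "e \<in> Units G" "mprod xs = e \<otimes> a"
      using c assms by (auto simp: unit_class_eq_iff Units_closed)
    then have "mprod xs \<in> Units G" using assms by simp
    then have "x \<in> Units G" using c s unit_factor[of x "mprod ys"] by simp
    then show False using xs s by (auto simp: atoms_def irreducible_def)
  qed
  ultimately show ?thesis by blast
qed

lemma irreducible_unit_mult: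
  assumes "e \<in> Units G" "x \<in> carrier G" "irreducible G x"
  shows "irreducible G (e \<otimes> x)"
proof -
  have "x \<sim> e \<otimes> x"
    using assms by (intro associated_sym[OF associatedI2'[of _ _ e]]) (auto simp: m_comm Units_closed)
  then show ?thesis using assms by (auto intro: irreducible_cong simp: Units_closed)
qed

text \<open>The bridge between the two notions of factorization: \<open>lengths\<close> counts lists
  of atoms of \<open>G\<close> with product exactly \<open>a\<close>, while tameness speaks of
  multisets of classes. They differ by a unit, which the first atom of a nonempty list can
  absorb.\<close>

lemma lengths_eq_size_fact_of:
  assumes a: "a \<in> carrier G"
  shows "lengths G a = size ` fact_of G a"
proof (cases "a \<in> Units G")
  case True
  then show ?thesis by (simp add: fact_of_unit lengths_def)
next
  case False
  show ?thesis
  proof (intro subset_antisym subsetI)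
    fix k assume "k \<in> lengths G a"
    then obtain xs where xs: "k = length xs" "set xs \<subseteq> carrier G" "factors G xs a"
      using False by (auto simp: lengths_def)
    then have "set xs \<subseteq> atoms G" "mprod xs = a" by (auto simp: factors_def atoms_def)
    then have "mset (map unit_class xs) \<in> fact_of G a"
      using mset_prod_reduced[OF xs(2)] by (auto simp: fact_of_def Fact_def atoms_reduced)
    then show "k \<in> size ` fact_of G a" using xs(1) by (force simp: image_iff)
  next
    fix k assume "k \<in> size ` fact_of G a"
    then obtain z where z: "z \<in> fact_of G a" "k = size z" by blast
    then have "z \<in> Fact G" by (simp add: fact_of_def)
    then obtain xs where xs: "set xs \<subseteq> atoms G" "z = mset (map unit_class xs)"
      by (rule Fact_listE)
    have c: "set xs \<subseteq> carrier G" using xs atoms_closed by auto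
    then have "unit_class a = unit_class (mprod xs)"
      using mset_prod_reduced z xs by (simp add: fact_of_def)
    then obtain e where e: "e \<in> Units G" "a = e \<otimes> mprod xs"
      using c a by (auto simp: unit_class_eq_iff)
    with False obtain x ys where s: "xs = x # ys" by (cases xs) auto
    then have "factors G ((e \<otimes> x) # ys) a"
      using xs e c irreducible_unit_mult[OF e(1), of x]
      by (auto simp: factors_def atoms_def m_assoc Units_closed)
    moreover have "set ((e \<otimes> x) # ys) \<subseteq> carrier G" "k = length ((e \<otimes> x) # ys)"
      using c e s z xs by (auto simp: Units_closed)
    ultimately show "k \<in> lengths G a"
      using False unfolding lengths_def by (auto intro!: exI[of _ "(e \<otimes> x) # ys"])
  qed
qed

end

lemma multiset_splitE:
  fixes z :: "'c multiset"
  assumes "size z = k + l"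
  obtains y y' where "z = y + y'" "size y = k" "size y' = l"
proof -
  obtain xs where xs: "z = mset xs" using ex_mset by metis
  then have "z = mset (take k xs) + mset (drop k xs)"
    by (metis append_take_drop_id mset_append)
  then show thesis using that[of "mset (take k xs)" "mset (drop k xs)"] xs assms by simp
qed

section \<open>Lengths of products, powers and factors\<close>

context comm_monoid_cancel
begin

lemma lengths_Units: "a \<in> Units G \<Longrightarrow> lengths G a = {0}"
  by (simp add: lengths_def)

lemma zero_in_lengths_iff: "0 \<in> lengths G a \<longleftrightarrow> a \<in> Units G"
  by (auto simp: lengths_def)

lemma lengths_atom: "x \<in> atoms G \<Longrightarrow> 1 \<in> lengths G x"
  using fact_of_atom[of x] by (force simp: lengths_eq_size_fact_of atoms_closed)

lemma lengths_mult:
  assumes "a \<in> carrier G" "b \<in> carrier G" "k \<in> lengths G a" "l \<in> lengths G b"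
  shows "k + l \<in> lengths G (a \<otimes> b)"
  using assms fact_of_union[OF assms(1,2)] by (force simp: lengths_eq_size_fact_of)

lemma lengths_nat_pow:
  fixes q :: nat
  assumes "a \<in> carrier G" "k \<in> lengths G a"
  shows "q * k \<in> lengths G (a [^] q)"
proof (induction q)
  case 0
  then show ?case by (simp add: zero_in_lengths_iff)
next
  case (Suc q)
  then show ?case using lengths_mult[OF _ assms(1) Suc assms(2)] assms by (simp add: add.commute)
qed

lemma lengths_unit_mult:
  assumes "a \<in> Units G" "c \<in> carrier G"
  shows "lengths G (a \<otimes> c) = lengths G c"
proof -
  have "unit_class (a \<otimes> c) = unit_class c"
    using assms by (subst unit_class_eq_iff) (auto simp: Units_closed)
  then show ?thesis using assms by (simp add: lengths_eq_size_fact_of fact_of_def Units_closed)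
qed

lemma length_one_atom:
  assumes "a \<in> carrier G" "1 \<in> lengths G a"
  shows "a \<in> atoms G"
proof -
  have "a \<notin> Units G" using assms by (auto simp: lengths_Units)
  then obtain xs where "length xs = 1" "set xs \<subseteq> carrier G" "factors G xs a"
    using assms by (auto simp: lengths_def)
  then show ?thesis by (auto simp: length_Suc_conv factors_def atoms_def)
qed

text \<open>Factor \<open>j\<close> of the \<open>h\<close> copies of \<open>a\<close> into
  \<open>m + d\<close> atoms and the remaining copies into \<open>m\<close> atoms.\<close>

lemma lengths_pow_progression:
  fixes h :: nat
  assumes "a \<in> carrier G" "m \<in> lengths G a" "m + d \<in> lengths G a" "j \<le> h"
  shows "h * m + j * d \<in> lengths G (a [^] h)"
proof -
  have "j * (m + d) + (h - j) * m \<in> lengths G (a [^] j \<otimes> a [^] (h - j))"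
    using assms by (intro lengths_mult lengths_nat_pow) auto
  moreover have "a [^] j \<otimes> a [^] (h - j) = a [^] h" using assms by (simp add: nat_pow_mult)
  moreover have "j * (m + d) + (h - j) * m = (j + (h - j)) * m + j * d"
    by (simp add: algebra_simps)
  ultimately show ?thesis using assms(4) by simp
qed

lemma fact_of_splitE:
  assumes a: "a \<in> carrier G" and z: "z \<in> fact_of G a" and k: "size z = k + l"
  obtains b c y y' where "b \<in> carrier G" "c \<in> carrier G" "a = b \<otimes> c"
    "y \<in> fact_of G b" "y' \<in> fact_of G c" "z = y + y'" "size y = k" "size y' = l"
proof -
  obtain y y' where y: "z = y + y'" "size y = k" "size y' = l"
    using k by (rule multiset_splitE)
  then have "y \<in> Fact G" using z by (simp add: fact_of_def Fact_union)
  then obtain b where b: "b \<in> carrier G" "y \<in> fact_of G b" by (rule Fact_valueE)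
  with a z y obtain c where "c \<in> carrier G" "y' \<in> fact_of G c" "a = b \<otimes> c"
    using fact_of_unionE by blast
  then show thesis using that b y by blast
qed

lemma lengths_splitE:
  assumes a: "a \<in> carrier G" and k: "k + l \<in> lengths G a"
  obtains b c where "b \<in> carrier G" "c \<in> carrier G" "a = b \<otimes> c"
    "k \<in> lengths G b" "l \<in> lengths G c"
proof -
  from k obtain z where "z \<in> fact_of G a" "size z = k + l"
    using a by (auto simp: lengths_eq_size_fact_of)
  with a obtain b c y y' where "b \<in> carrier G" "c \<in> carrier G" "a = b \<otimes> c"
    "y \<in> fact_of G b" "y' \<in> fact_of G c" "size y = k" "size y' = l"
    by (rule fact_of_splitE)
  then show thesis using that by (force simp: lengths_eq_size_fact_of)
qed

lemma Units_mprodD: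
  assumes "set xs \<subseteq> carrier G" "mprod xs \<in> Units G"
  shows "set xs \<subseteq> Units G"
  using assms
proof (induction xs)
  case (Cons x xs)
  then have x: "x \<in> carrier G" and xs: "mprod xs \<in> carrier G" by auto
  then have "x \<in> Units G" using Cons.prems unit_factor[of x "mprod xs"] by simp
  moreover have "mprod xs \<in> Units G"
    using Cons.prems x xs unit_factor[of "mprod xs" x] by (simp add: m_comm)
  ultimately show ?case using Cons by simp
qed simp

end

section \<open>Strongly primary monoids\<close>

locale strongly_primary_monoid = comm_monoid_cancel +
  assumes strongly_primary: "strongly_primary G"
begin

lemma nonunit_obtain: obtains a where "a \<in> nonunits G"
  using strongly_primary by (auto simp: strongly_primary_def)

lemma primary_exponent:
  assumes "a \<in> nonunits G"
  shows "primary_exponent G a \<ge> 1" (is ?A)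
    and "nonunit_power G (primary_exponent G a) \<subseteq> a <# carrier G" (is ?B)
proof -
  have "\<exists>n. n \<ge> 1 \<and> nonunit_power G n \<subseteq> a <# carrier G"
    using strongly_primary assms by (auto simp: strongly_primary_def)
  then have "?A \<and> ?B" unfolding primary_exponent_def by (rule LeastI_ex)
  then show ?A ?B by auto
qed

lemma mprod_nonunits_divisible:
  assumes "a \<in> nonunits G" "set xs \<subseteq> nonunits G" "length xs = primary_exponent G a"
  shows "\<exists>c\<in>carrier G. mprod xs = a \<otimes> c"
proof -
  have "mprod xs \<in> nonunit_power G (primary_exponent G a)"
    using assms by (auto simp: nonunit_power_def)
  then show ?thesis using primary_exponent(2)[OF assms(1)] by (auto simp: l_coset_def)
qed

text \<open>In a longer list, the first \<open>primary_exponent G (mprod xs)\<close> entries would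
  already have a product divisible by the whole product. Cancellation would then turn the remaining
  entries into units. Both the finiteness of sets of lengths and the existence of factorizations
  rest on this bound.\<close>

lemma length_nonunits_le:
  assumes a: "mprod xs \<in> nonunits G" and xs: "set xs \<subseteq> nonunits G"
  shows "length xs \<le> primary_exponent G (mprod xs)"
proof (rule ccontr)
  define n where "n = primary_exponent G (mprod xs)"
  assume "\<not> ?thesis"
  then have n: "n < length xs" by (simp add: n_def)
  have "set (take n xs) \<subseteq> nonunits G" "set (drop n xs) \<subseteq> nonunits G"
    using xs by (auto dest: in_set_takeD in_set_dropD)
  note sub = this
  have xc: "set xs \<subseteq> carrier G" using xs by (auto simp: nonunits_def)
  then have cl: "set (take n xs) \<subseteq> carrier G" "set (drop n xs) \<subseteq> carrier G"
    using set_take_subset[of n xs] set_drop_subset[of n xs] by blast+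
  obtain c where c: "c \<in> carrier G" "mprod (take n xs) = mprod xs \<otimes> c"
    using mprod_nonunits_divisible[OF a sub(1)] n by (auto simp: n_def)
  let ?d = "mprod (drop n xs)"
  have dc: "?d \<in> carrier G" "mprod xs \<in> carrier G" using cl xc by auto
  have "mprod xs = mprod xs \<otimes> (c \<otimes> ?d)"
    using mprod_append[OF cl] c dc by (simp add: m_assoc)
  then have "c \<otimes> ?d = \<one>"
    using c dc by (metis l_cancel m_closed one_closed r_one)
  then have "?d \<in> Units G" using c dc unit_factor[of ?d c] by (simp add: m_comm)
  then have "set (drop n xs) \<subseteq> Units G" using Units_mprodD cl by blast
  moreover have "drop n xs \<noteq> []" using n by simp
  ultimately show False using sub(2) by (cases "drop n xs") (auto simp: nonunits_def)
qed

lemma finite_lengths: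
  assumes "a \<in> carrier G"
  shows "finite (lengths G a)"
proof (cases "a \<in> Units G")
  case True
  then show ?thesis by (simp add: lengths_Units)
next
  case False
  then have a: "a \<in> nonunits G" using assms by (simp add: nonunits_def)
  have "lengths G a \<subseteq> {..primary_exponent G a}"
  proof
    fix k assume "k \<in> lengths G a"
    then obtain xs where xs: "k = length xs" "set xs \<subseteq> carrier G" "factors G xs a"
      using False by (auto simp: lengths_def)
    then have "mprod xs = a" "set xs \<subseteq> nonunits G"
      by (auto simp: factors_def irreducible_def nonunits_def)
    then show "k \<in> {..primary_exponent G a}" using length_nonunits_le[of xs] a xs(1) by auto
  qed
  then show ?thesis using finite_subset by blast
qed

text \<open>Among the lists of nonunits with product \<open>a\<close> there is a longest one. Its
  entries are atoms, since splitting any other entry into two nonunits would lengthen the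
  list.\<close>

lemma nonunit_factors_exist:
  assumes a: "a \<in> nonunits G"
  obtains xs where "xs \<noteq> []" "set xs \<subseteq> carrier G" "factors G xs a"
proof -
  let ?P = "\<lambda>xs. set xs \<subseteq> nonunits G \<and> mprod xs = a"
  have "?P [a]" using a by (auto simp: nonunits_def)
  moreover have "\<forall>xs. ?P xs \<longrightarrow> length xs < Suc (primary_exponent G a)"
    using length_nonunits_le a less_Suc_eq_le by blast
  ultimately have "\<exists>xs. ?P xs \<and> (\<forall>ys. ?P ys \<longrightarrow> length ys \<le> length xs)"
    by (rule ex_has_greatest_nat[where P = ?P and f = length])
  then obtain xs where xs: "?P xs" and mx: "\<And>ys. ?P ys \<Longrightarrow> length ys \<le> length xs"
    by iprover
  have c: "set xs \<subseteq> carrier G" using xs by (auto simp: nonunits_def)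
  have "x \<in> atoms G" if x: "x \<in> set xs" for x
  proof (rule ccontr)
    assume "x \<notin> atoms G"
    moreover have "x \<in> nonunits G" using x xs by blast
    ultimately obtain u v where uv: "u \<in> carrier G" "v \<in> carrier G" "x = u \<otimes> v"
      "u \<notin> Units G" "v \<notin> Units G"
      using atoms_iff[OF comm_monoid_cancel_axioms, of x] by blast
    obtain ys zs where s: "xs = ys @ x # zs" using x by (meson split_list)
    have "mprod (ys @ u # v # zs) = mprod xs"
      using s c uv by (simp add: mprod_append m_assoc)
    moreover have "set (ys @ u # v # zs) \<subseteq> nonunits G"
      using xs s uv by (auto simp: nonunits_def)
    ultimately show False using mx[of "ys @ u # v # zs"] xs s by simp
  qed
  then have "factors G xs a" using xs by (auto simp: factors_def atoms_def)
  moreover have "xs \<noteq> []" using xs a by (auto simp: nonunits_def)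
  ultimately show thesis using that c by blast
qed

lemma atomic: "atomic_monoid G"
  unfolding atomic_monoid_def by (meson nonunit_factors_exist)

lemma lengths_nonempty:
  assumes "a \<in> carrier G"
  shows "lengths G a \<noteq> {}"
proof (cases "a \<in> Units G")
  case False
  then have "a \<in> nonunits G" using assms by (simp add: nonunits_def)
  then obtain xs where "xs \<noteq> []" "set xs \<subseteq> carrier G" "factors G xs a"
    by (rule nonunit_factors_exist)
  then show ?thesis using False by (auto simp: lengths_def)
qed (simp add: lengths_Units)

lemma lengths_primary_exponent_divides:
  assumes a: "a \<in> nonunits G" and b: "b \<in> carrier G"
    and k: "primary_exponent G a \<in> lengths G b"
  shows "\<exists>c\<in>carrier G. b = a \<otimes> c"
proof -
  have "b \<notin> Units G" using k primary_exponent(1)[OF a] by (auto simp: lengths_Units)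
  then obtain xs where xs: "primary_exponent G a = length xs" "set xs \<subseteq> carrier G"
    "factors G xs b"
    using k by (auto simp: lengths_def)
  then have "mprod xs = b" "set xs \<subseteq> nonunits G"
    by (auto simp: factors_def irreducible_def nonunits_def)
  then show ?thesis using mprod_nonunits_divisible[OF a, of xs] xs by auto
qed

text \<open>Cut the factorization into blocks of \<open>primary_exponent G a\<close> atoms; each
  block contributes one factor \<open>a\<close>.\<close>

lemma lengths_ge_pow_divides:
  fixes q :: nat
  assumes a: "a \<in> nonunits G" and b: "b \<in> carrier G"
    and k: "k \<in> lengths G b" "q * primary_exponent G a \<le> k"
  shows "\<exists>c\<in>carrier G. b = a [^] q \<otimes> c"
  using b k
proof (induction q arbitrary: b k)
  case 0
  then show ?case by auto
next
  case (Suc q)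
  let ?n = "primary_exponent G a"
  have ac: "a \<in> carrier G" using a by (simp add: nonunits_def)
  have "?n + (k - ?n) \<in> lengths G b" using Suc.prems by simp
  with Suc.prems(1) obtain b1 b2 where b: "b1 \<in> carrier G" "b2 \<in> carrier G" "b = b1 \<otimes> b2"
    "?n \<in> lengths G b1" "k - ?n \<in> lengths G b2"
    by (rule lengths_splitE)
  obtain c1 where c1: "c1 \<in> carrier G" "b1 = a \<otimes> c1"
    using lengths_primary_exponent_divides[OF a] b by blast
  obtain c2 where c2: "c2 \<in> carrier G" "b2 = a [^] q \<otimes> c2"
    using Suc.IH[of b2 "k - ?n"] b(2,5) Suc.prems(3) by (auto simp: le_diff_conv2)
  have "b = a [^] Suc q \<otimes> (c1 \<otimes> c2)"
    using b(3) c1 c2 ac by (simp add: m_ac)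
  then show ?case using c1 c2 by blast
qed

lemma lengths_ge_divides:
  assumes "a \<in> nonunits G" "b \<in> carrier G" "k \<in> lengths G b" "primary_exponent G a \<le> k"
  shows "\<exists>c\<in>carrier G. b = a \<otimes> c"
  using lengths_ge_pow_divides[of a b k 1] assms by (auto simp: nonunits_def)

lemma nonunit_lengths_pos:
  "a \<in> nonunits G \<Longrightarrow> k \<in> lengths G a \<Longrightarrow> k \<ge> 1"
  using zero_in_lengths_iff[of a] by (cases k) (auto simp: nonunits_def)

text \<open>Provides the measure for the inductions that split off a nonunit repeatedly.\<close>

lemma Max_lengths_less:
  assumes a: "a \<in> nonunits G" and c: "c \<in> carrier G"
  shows "Max (lengths G c) < Max (lengths G (a \<otimes> c))"
proof -
  have ac: "a \<in> carrier G" using a by (simp add: nonunits_def)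
  obtain k where k: "k \<in> lengths G a" using lengths_nonempty[OF ac] by blast
  have "Max (lengths G c) \<in> lengths G c" using finite_lengths lengths_nonempty c by simp
  then have "k + Max (lengths G c) \<in> lengths G (a \<otimes> c)" using lengths_mult ac c k by blast
  then have "k + Max (lengths G c) \<le> Max (lengths G (a \<otimes> c))"
    using finite_lengths ac c by simp
  then show ?thesis using nonunit_lengths_pos[OF a k] by linarith
qed

lemma pow_times_bounded:
  assumes a: "a \<in> nonunits G" and b: "b \<in> carrier G"
  shows "\<exists>(q::nat). \<exists>c\<in>carrier G. b = a [^] q \<otimes> c \<and> lengths G c \<subseteq> {..<primary_exponent G a}"
  using b
proof (induction "Max (lengths G b)" arbitrary: b rule: less_induct)
  case less
  have ac: "a \<in> carrier G" using a by (simp add: nonunits_def)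
  show ?case
  proof (cases "lengths G b \<subseteq> {..<primary_exponent G a}")
    case True
    then show ?thesis using less.prems by (intro exI[of _ 0] bexI[of _ b]) auto
  next
    case False
    then obtain c where c: "c \<in> carrier G" "b = a \<otimes> c"
      using lengths_ge_divides[OF a less.prems] by force
    then obtain q :: nat and d where d: "d \<in> carrier G" "c = a [^] q \<otimes> d"
      "lengths G d \<subseteq> {..<primary_exponent G a}"
      using less.hyps[of c] Max_lengths_less[OF a] by blast
    have "b = a [^] Suc q \<otimes> d" using c d ac by (simp add: m_ac)
    then show ?thesis using d by blast
  qed
qed

end

section \<open>Elasticities and singleton sets of lengths\<close>

lemma Inf_nat_mem_le:
  fixes L :: "nat set"
  assumes "k \<in> L"
  shows "Inf L \<in> L" "Inf L \<le> k"
  using assms Inf_nat_def1[of L] by (auto intro: cInf_lower)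

lemma rho_finite:
  assumes "finite L" "k \<in> L" "0 \<notin> L"
  shows "rho L = ereal (real (Max L) / real (Inf L))"
proof -
  have "Max L \<in> L" using assms by (intro Max_in) auto
  then have "(SUP l\<in>L. enat l) = enat (Max L)"
    using assms by (intro antisym SUP_least SUP_upper) auto
  moreover have "Inf L \<noteq> 0" using Inf_nat_mem_le(1)[OF assms(2)] assms(3) by metis
  ultimately show ?thesis using assms by (auto simp: rho_def)
qed

text \<open>The elasticity is at least \<open>k' / k\<close>, hence at least
  \<open>1 + q / k\<close>. The parameter \<open>q\<close> is the exponent in
  \<open>a [^] q \<otimes> c\<close>: both the spread of the lengths and the smaller length grow
  linearly with it, so it cancels from the bound.\<close>

lemma rho_ge:
  assumes "finite L" "0 \<notin> L" and k: "k \<in> L" "k' \<in> L" and q: "k + q \<le> k'" "k \<le> q * c"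
  shows "rho L \<ge> ereal (1 + 1 / real c)"
proof -
  define m where "m = Inf L"
  define n where "n = Max L"
  have m: "m > 0" "m \<le> k" using Inf_nat_mem_le[OF k(1)] assms(2) by (auto simp: m_def intro!: Nat.gr0I)
  have n: "k + q \<le> n" unfolding n_def using Max_ge[OF assms(1) k(2)] q(1) by linarith
  have c: "c > 0" using m q by (intro Nat.gr0I) auto
  have k0: "real k > 0" using m by simp
  have "1 / real c \<le> real q / real k"
    using c k0 q(2) by (simp add: field_simps flip: of_nat_mult)
  then have "1 + 1 / real c \<le> (real k + real q) / real k"
    using k0 by (simp add: field_simps)
  also have "\<dots> \<le> real n / real m" using m n by (intro frac_le) auto
  finally show ?thesis
    using rho_finite[OF assms(1) k(1) assms(2)] by (simp add: m_def n_def)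
qed

context strongly_primary_monoid
begin

lemma not_half_factorial_obtain:
  assumes "\<not> half_factorial G"
  obtains a i j where "a \<in> nonunits G" "i \<in> lengths G a" "j \<in> lengths G a" "i < j"
proof -
  obtain a where a: "a \<in> carrier G" "card (lengths G a) \<noteq> 1"
    using assms by (auto simp: half_factorial_def sets_of_lengths_def)
  have "a \<notin> Units G" using a by (auto simp: lengths_Units)
  then have nu: "a \<in> nonunits G" using a by (simp add: nonunits_def)
  obtain i where i: "i \<in> lengths G a" using lengths_nonempty[OF a(1)] by blast
  have "lengths G a \<noteq> {i}" using a(2) by auto
  then obtain j where "j \<in> lengths G a" "j \<noteq> i" using i by blast
  then show thesis using that nu i by (meson nat_neq_iff)
qed

lemma rho_gap:
  assumes "\<not> half_factorial G"
  shows "\<exists>\<beta>::rat. \<beta> > 1 \<and>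
    (\<forall>L\<in>sets_of_lengths G. rho L \<noteq> 1 \<longrightarrow> rho L \<ge> ereal (of_rat \<beta>))"
proof -
  obtain a i j where a: "a \<in> nonunits G" "i \<in> lengths G a" "j \<in> lengths G a" "i < j"
    using not_half_factorial_obtain[OF assms] .
  define n where "n = primary_exponent G a"
  have n: "n \<ge> 1" using primary_exponent(1)[OF a(1)] by (simp add: n_def)
  have ac: "a \<in> carrier G" using a by (simp add: nonunits_def)
  \<comment> \<open>For \<open>b = a [^] q \<otimes> c\<close> with \<open>q > 0\<close> and a
    length \<open>l < n\<close> of \<open>c\<close>, the lengths \<open>q * i + l\<close> and
    \<open>q * j + l\<close> differ by at least \<open>q\<close>, and the smaller is at most
    \<open>q * (i + n)\<close>. For \<open>q = 0\<close> all lengths are below \<open>n\<close>, and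
    two different ones differ by at least 1.\<close>
  define \<beta> :: rat where "\<beta> = 1 + 1 / of_nat (i + n)"
  have \<beta>: "of_rat \<beta> = 1 + 1 / real (i + n)" by (simp add: \<beta>_def of_rat_add of_rat_divide)
  have "rho L \<ge> ereal (of_rat \<beta>)" if L: "L \<in> sets_of_lengths G" and rho: "rho L \<noteq> 1" for L
  proof -
    obtain b where b: "b \<in> carrier G" "L = lengths G b" using L by (auto simp: sets_of_lengths_def)
    have fin: "finite L" using b finite_lengths by simp
    have "L \<noteq> {0}" using rho by (auto simp: rho_def)
    then have bu: "b \<notin> Units G" using b by (auto simp: lengths_Units)
    then have L0: "0 \<notin> L" using b by (simp add: zero_in_lengths_iff)
    obtain q :: nat and c where c: "c \<in> carrier G" "b = a [^] q \<otimes> c" "lengths G c \<subseteq> {..<n}"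
      using pow_times_bounded[OF a(1) b(1)] by (auto simp: n_def)
    obtain l where l: "l \<in> lengths G c" using lengths_nonempty[OF c(1)] by blast
    show ?thesis
    proof (cases "q = 0")
      case True
      then have bc: "b = c" using c by simp
      have lL: "l \<in> L" using l b bc by simp
      have "L \<noteq> {l}"
      proof
        assume "L = {l}"
        moreover have "l \<noteq> 0" using lL L0 by metis
        ultimately have "rho L = 1"
          using rho_finite[OF fin lL L0] by (simp add: one_ereal_def)
        then show False using rho by simp
      qed
      then obtain l' where l': "l' \<in> L" "l' \<noteq> l" using lL by blast
      obtain k k' where k: "k \<in> L" "k' \<in> L" "k < k'" using l' lL by (meson nat_neq_iff)
      have "k \<le> 1 * (i + n)" using k b bc c by auto
      then show ?thesis using rho_ge[OF fin L0 k(1,2), of 1 "i + n"] k(3) \<beta> by simp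
    next
      case False
      have "q * i + l \<in> L" "q * j + l \<in> L"
        using lengths_mult[OF _ c(1) lengths_nat_pow[OF ac] l] a ac b c by auto
      moreover have "q * i + q \<le> q * j"
        using a(4) mult_le_mono2[of "i + 1" j q] by simp
      then have "q * i + l + q \<le> q * j + l" by simp
      moreover have "l < n" using l c by auto
      then have "l \<le> q * n" using False mult_le_mono[of 1 q l n] by simp
      then have "q * i + l \<le> q * (i + n)" by (simp add: algebra_simps)
      ultimately show ?thesis using rho_ge[OF fin L0] \<beta> by metis
    qed
  qed
  moreover have "\<beta> > 1" using n by (simp add: \<beta>_def)
  ultimately show ?thesis by blast
qed

lemma singletons_bounded:
  assumes "\<not> half_factorial G"
  shows "\<exists>n. \<forall>k\<ge>n. {k} \<notin> sets_of_lengths G"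
proof -
  obtain a i j where a: "a \<in> nonunits G" "i \<in> lengths G a" "j \<in> lengths G a" "i < j"
    using not_half_factorial_obtain[OF assms] .
  have ac: "a \<in> carrier G" using a by (simp add: nonunits_def)
  have "{k} \<notin> sets_of_lengths G" if k: "k \<ge> primary_exponent G a" for k
  proof
    assume "{k} \<in> sets_of_lengths G"
    then obtain b where b: "b \<in> carrier G" "lengths G b = {k}" by (auto simp: sets_of_lengths_def)
    then obtain c where c: "c \<in> carrier G" "b = a \<otimes> c"
      using lengths_ge_divides[OF a(1) b(1) _ k] by auto
    obtain l where l: "l \<in> lengths G c" using lengths_nonempty[OF c(1)] by blast
    have "i + l \<in> {k}" "j + l \<in> {k}" using lengths_mult[OF ac c(1) _ l] a b c by auto
    then show False using a(4) by simp
  qed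
  then show ?thesis by blast
qed

end

section \<open>Sufficient conditions for local tameness\<close>

lemma fact_dist_union_le: "fact_dist (y + z) (y' + z) \<le> max (size y) (size y')"
proof -
  let ?w = "(y + z) \<inter># (y' + z)"
  have "y + z - ?w \<subseteq># y" "y' + z - ?w \<subseteq># y'"
    by (auto simp: subseteq_mset_def)
  then have "size (y + z - ?w) \<le> size y" "size (y' + z - ?w) \<le> size y'"
    by (auto intro: size_mset_mono)
  then show ?thesis by (auto simp: fact_dist_def Let_def)
qed

lemma size_le_fact_dist:
  "size z \<le> size z' + fact_dist z z'" "size z' \<le> size z + fact_dist z z'"
proof -
  let ?w = "z \<inter># z'"
  have "z = (z - ?w) + ?w" "z' = (z' - ?w) + ?w"
    by (intro subset_mset.diff_add[symmetric] inf_le1 inf_le2; simp)+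
  then have "size z = size (z - ?w) + size ?w" "size z' = size (z' - ?w) + size ?w"
    by (metis size_union)+
  then show "size z \<le> size z' + fact_dist z z'" "size z' \<le> size z + fact_dist z z'"
    by (auto simp: fact_dist_def Let_def)
qed

lemma tame_degree_finite_iff:
  "tame_degree H u < \<infinity> \<longleftrightarrow> (\<exists>N. \<forall>a\<in>carrier H. fact_of H a \<inter> fact_mult H u \<noteq> {} \<longrightarrow>
    (\<forall>z\<in>fact_of H a. \<exists>z'\<in>fact_of H a \<inter> fact_mult H u. fact_dist z z' \<le> N))"
  (is "?A \<longleftrightarrow> (\<exists>N. ?P N)")
proof -
  let ?Q = "\<lambda>N. \<forall>a\<in>carrier H. fact_of H a \<inter> fact_mult H u \<noteq> {} \<longrightarrow>
    (\<forall>z\<in>fact_of H a. \<exists>z'\<in>fact_of H a \<inter> fact_mult H u. enat (fact_dist z z') \<le> N)"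
  have eq: "tame_degree H u = (LEAST N. ?Q N)" by (simp add: tame_degree_def)
  show ?thesis
  proof
    assume fin: "tame_degree H u < \<infinity>"
    \<comment> \<open>At \<open>\<infinity>\<close> the condition only asks for some
      \<open>z'\<close>, which its premise supplies. So the least value really satisfies the
      condition.\<close>
    have "?Q \<infinity>" by auto
    then have "?Q (tame_degree H u)" unfolding eq by (rule LeastI)
    moreover obtain N where "tame_degree H u = enat N" using fin by auto
    ultimately have "?P N" by simp
    then show "\<exists>N. ?P N" by blast
  next
    assume "\<exists>N. ?P N"
    then obtain N where "?P N" by blast
    then have "?Q (enat N)" by simp
    then have "tame_degree H u \<le> enat N" unfolding eq by (rule Least_le)
    also have "\<dots> < \<infinity>" by simp
    finally show ?A .
  qed
qed

context strongly_primary_monoid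
begin

text \<open>To make the atom \<open>x\<close> appear in a factorization, it is enough to change a
  block of \<open>primary_exponent G x\<close> atoms, as the product of such a block is divisible by
  \<open>x\<close>. Distances are therefore governed by elements \<open>x \<otimes> c\<close> with a
  short factorization.\<close>

lemma locally_tameI:
  assumes "\<And>x. x \<in> atoms G \<Longrightarrow> \<exists>B. \<forall>c\<in>carrier G. \<forall>k\<in>lengths G (x \<otimes> c).
    k \<le> primary_exponent G x \<longrightarrow> (\<exists>l\<in>lengths G c. l \<le> B)"
  shows "locally_tame G"
proof -
  have "tame_degree G u < \<infinity>" if u: "u \<in> atoms (reduced G)" for u
  proof -
    obtain x where x: "x \<in> atoms G" "u = unit_class x" using u by (auto simp: atoms_reduced)
    have xc: "x \<in> carrier G" and xn: "x \<in> nonunits G"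
      using x by (auto simp: atoms_def nonunits_def irreducible_def)
    define n where "n = primary_exponent G x"
    obtain B where B: "\<And>c k. c \<in> carrier G \<Longrightarrow> k \<in> lengths G (x \<otimes> c) \<Longrightarrow> k \<le> n \<Longrightarrow>
        \<exists>l\<in>lengths G c. l \<le> B"
      using assms[OF x(1)] by (auto simp: n_def)
    have short: "\<exists>y\<in>fact_of G c. {#u#} + y \<in> fact_of G (x \<otimes> c) \<and> size ({#u#} + y) \<le> Suc B"
      if c: "c \<in> carrier G" and z: "z \<in> fact_of G (x \<otimes> c)" "size z \<le> n" for c z
    proof -
      have "size z \<in> lengths G (x \<otimes> c)" using c xc z by (simp add: lengths_eq_size_fact_of)
      then obtain y where "y \<in> fact_of G c" "size y \<le> B"
        using B[OF c] z c by (auto simp: lengths_eq_size_fact_of)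
      then show ?thesis using fact_of_union[OF xc c fact_of_atom[OF x(1)]] x(2) by auto
    qed
    \<comment> \<open>At most \<open>n\<close> atoms are removed; the atom \<open>u\<close> and at
      most \<open>B\<close> further atoms replace them.\<close>
    have "\<exists>z'\<in>fact_of G a \<inter> fact_mult G u. fact_dist z z' \<le> max n (Suc B)"
      if a: "a \<in> carrier G" "fact_of G a \<inter> fact_mult G u \<noteq> {}" and z: "z \<in> fact_of G a" for a z
    proof (cases "size z \<le> n")
      case True
      obtain w where "{#u#} + w \<in> fact_of G a" using a(2) by (auto simp: fact_mult_def)
      then obtain c where c: "c \<in> carrier G" "a = x \<otimes> c"
        using fact_of_unionE[OF a(1) xc fact_of_atom[OF x(1)]] x(2) by metis
      obtain y where y: "y \<in> fact_of G c" "{#u#} + y \<in> fact_of G a" "size ({#u#} + y) \<le> Suc B"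
        using short[OF c(1), of z] z True c(2) by blast
      have "{#u#} + y \<in> fact_mult G u" using y(1) by (auto simp: fact_mult_def fact_of_def)
      moreover have "fact_dist z ({#u#} + y) \<le> max n (Suc B)"
        using fact_dist_union_le[of z "{#}" "{#u#} + y"] y(3) True by simp
      ultimately show ?thesis using y(2) by blast
    next
      case False
      \<comment> \<open>Only the block \<open>y1\<close> of \<open>n\<close> atoms is exchanged. The
        rest \<open>y2\<close> is common to both factorizations, so it does not add to their
        distance.\<close>
      then have "size z = n + (size z - n)" by simp
      with a(1) z obtain b1 b2 y1 y2 where b: "b1 \<in> carrier G" "b2 \<in> carrier G" "a = b1 \<otimes> b2"
        "y1 \<in> fact_of G b1" "y2 \<in> fact_of G b2" "z = y1 + y2" "size y1 = n"
        by (rule fact_of_splitE)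
      then have "n \<in> lengths G b1" by (force simp: lengths_eq_size_fact_of)
      then obtain c where c: "c \<in> carrier G" "b1 = x \<otimes> c"
        using lengths_primary_exponent_divides[OF xn b(1)] by (auto simp: n_def)
      obtain y where y: "y \<in> fact_of G c" "{#u#} + y \<in> fact_of G b1" "size ({#u#} + y) \<le> Suc B"
        using short[OF c(1), of y1] b c(2) by blast
      have "{#u#} + y + y2 \<in> fact_of G a" using fact_of_union[OF b(1,2) y(2) b(5)] b(3) by simp
      moreover have "{#u#} + y + y2 \<in> fact_mult G u"
        using y(1) b(5) by (auto simp: fact_mult_def fact_of_def Fact_def)
      moreover have "fact_dist z ({#u#} + y + y2) \<le> max n (Suc B)"
        using fact_dist_union_le[of y1 y2 "{#u#} + y"] y(3) b(6,7) by simp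
      ultimately show ?thesis by blast
    qed
    then show ?thesis unfolding tame_degree_finite_iff by blast
  qed
  then show ?thesis using atomic by (simp add: locally_tame_def)
qed

lemma locally_tame_of_bounded_min_lengths:
  assumes "(SUP c\<in>carrier G. enat (Inf (lengths G c))) < \<infinity>"
  shows "locally_tame G"
proof -
  obtain B where B: "(SUP c\<in>carrier G. enat (Inf (lengths G c))) = enat B" using assms by auto
  have "\<exists>l\<in>lengths G c. l \<le> B" if c: "c \<in> carrier G" for c
  proof -
    have "enat (Inf (lengths G c)) \<le> (SUP c\<in>carrier G. enat (Inf (lengths G c)))"
      using c by (rule SUP_upper)
    then have "enat (Inf (lengths G c)) \<le> enat B" using B by simp
    then have "Inf (lengths G c) \<le> B" by simp
    then show ?thesis using Inf_nat_def1[OF lengths_nonempty[OF c]] by blast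
  qed
  then show ?thesis by (intro locally_tameI) blast
qed

lemma atom_obtain: obtains x where "x \<in> atoms G"
proof -
  obtain a where "a \<in> nonunits G" by (rule nonunit_obtain)
  then obtain xs where "xs \<noteq> []" "set xs \<subseteq> carrier G" "factors G xs a"
    by (rule nonunit_factors_exist)
  then have "hd xs \<in> atoms G" using hd_in_set[of xs] by (auto simp: factors_def atoms_def)
  then show thesis by (rule that)
qed

text \<open>Strip powers of \<open>u\<close> off a product of \<open>k\<close> atoms: each block of \<open>primary_exponent G u\<close> atoms
  contributes at most \<open>R\<close> copies of \<open>u\<close> and leaves fewer atoms than it used.\<close>

lemma pow_exponent_bounded:
  fixes e :: nat
  assumes u: "u \<in> nonunits G"
    and R: "\<And>b l. b \<in> carrier G \<Longrightarrow> primary_exponent G u \<in> lengths G b \<Longrightarrow>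
      l \<in> lengths G b \<Longrightarrow> l \<le> R"
    and "c \<in> carrier G" "k \<in> lengths G (u [^] e \<otimes> c)"
  shows "e \<le> Suc k * R"
  using assms(3,4)
proof (induction k arbitrary: e c rule: less_induct)
  case (less k)
  define m where "m = primary_exponent G u"
  have uc: "u \<in> carrier G" using u by (simp add: nonunits_def)
  have e_le: "e \<le> R" if c: "c \<in> carrier G" and m: "m \<in> lengths G (u [^] e \<otimes> c)" for c and e :: nat
  proof -
    obtain i where i: "i \<in> lengths G u" using lengths_nonempty[OF uc] by blast
    obtain j where j: "j \<in> lengths G c" using lengths_nonempty[OF c] by blast
    have "e * i + j \<in> lengths G (u [^] e \<otimes> c)"
      using lengths_mult[OF _ c lengths_nat_pow[OF uc i] j] uc by simp
    then have "e * i + j \<le> R" using R[OF _ m[unfolded m_def]] c uc by simp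
    moreover have "e * 1 \<le> e * i" using nonunit_lengths_pos[OF u i] by (rule mult_le_mono2)
    ultimately show ?thesis by linarith
  qed
  show ?case
  proof (cases "k < m")
    case True
    \<comment> \<open>The bound \<open>R\<close> is only available for elements that have
      \<open>m\<close> as a length. Multiplying by \<open>m - k\<close> copies of an atom produces
      such an element, still divisible by \<open>u [^] e\<close>.\<close>
    obtain x where x: "x \<in> atoms G" by (rule atom_obtain)
    then have xc: "x \<in> carrier G" by (rule atoms_closed)
    have "(m - k) * 1 \<in> lengths G (x [^] (m - k))"
      using lengths_nat_pow[OF xc lengths_atom[OF x]] .
    then have "k + (m - k) * 1 \<in> lengths G (u [^] e \<otimes> c \<otimes> x [^] (m - k))"
      using lengths_mult[OF _ _ less.prems(2)] less.prems(1) uc xc by simp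
    then have "m \<in> lengths G (u [^] e \<otimes> (c \<otimes> x [^] (m - k)))"
      using True less.prems uc xc by (simp add: m_assoc)
    then have "e \<le> R" using e_le[of "c \<otimes> x [^] (m - k)" e] less.prems xc by simp
    then show ?thesis by simp
  next
    case False
    let ?b = "u [^] e \<otimes> c"
    have bc: "?b \<in> carrier G" using less.prems uc by simp
    have "m + (k - m) \<in> lengths G ?b" using False less.prems by simp
    with bc obtain b1 b2 where b: "b1 \<in> carrier G" "b2 \<in> carrier G" "?b = b1 \<otimes> b2"
      "m \<in> lengths G b1" "k - m \<in> lengths G b2"
      by (rule lengths_splitE)
    obtain f :: nat and d where d: "d \<in> carrier G" "b1 = u [^] f \<otimes> d" "lengths G d \<subseteq> {..<m}"
      using pow_times_bounded[OF u b(1)] by (auto simp: m_def)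
    have f: "f \<le> R" using e_le d b by blast
    show ?thesis
    proof (cases "e \<le> f")
      case True
      then show ?thesis using f by simp
    next
      case False
      have "u [^] f \<otimes> (u [^] (e - f) \<otimes> c) = u [^] e \<otimes> c"
        using False uc less.prems by (simp add: nat_pow_mult flip: m_assoc)
      also have "\<dots> = u [^] f \<otimes> (d \<otimes> b2)" using b d uc by (simp add: m_assoc)
      finally have eq: "u [^] (e - f) \<otimes> c = d \<otimes> b2"
        by (rule l_cancel) (use uc d b less.prems in auto)
      obtain s where s: "s \<in> lengths G d" using lengths_nonempty[OF d(1)] by blast
      then have sm: "s < m" using d by auto
      have "s + (k - m) \<in> lengths G (u [^] (e - f) \<otimes> c)"
        using lengths_mult[OF d(1) b(2) s b(5)] eq by simp
      then have "e - f \<le> Suc (s + (k - m)) * R"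
        using less.IH[of "s + (k - m)" c "e - f"] sm \<open>\<not> k < m\<close> less.prems by simp
      \<comment> \<open>Since \<open>s < m\<close>, the new length \<open>s + (k - m)\<close> is
        less than \<open>k\<close>. Each round thus costs one \<open>R\<close> and lowers
        \<open>k\<close>; the extra one in \<open>Suc k\<close> pays for the final block of fewer
        than \<open>m\<close> atoms.\<close>
      also have "\<dots> \<le> k * R" using sm \<open>\<not> k < m\<close> by (intro mult_le_mono1) simp
      finally show ?thesis using f by simp
    qed
  qed
qed

text \<open>One length of an element bounds all of them: a much longer factorization would make a
  higher power of \<open>u\<close> divide the element than \<open>pow_exponent_bounded\<close>
  allows. If \<open>x \<otimes> c\<close> has a short factorization, this applies to its length
  \<open>1 + l\<close>, for any length \<open>l\<close> of \<open>c\<close>.\<close>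

lemma locally_tame_of_rho_k:
  assumes u: "u \<in> nonunits G" and fin: "rho_k G (primary_exponent G u) < \<infinity>"
  shows "locally_tame G"
proof (rule locally_tameI)
  define m where "m = primary_exponent G u"
  obtain R where R: "rho_k G m = enat R" using fin by (auto simp: m_def)
  have R: "l \<le> R" if "b \<in> carrier G" "m \<in> lengths G b" "l \<in> lengths G b" for b l
  proof -
    have "enat l \<le> (SUP l\<in>lengths G b. enat l)" using that by (intro SUP_upper)
    also have "\<dots> \<le> rho_k G m"
      unfolding rho_k_def using that by (intro SUP_upper) (auto simp: sets_of_lengths_def)
    finally show ?thesis using R by simp
  qed
  have bound: "l < Suc (Suc k * R) * m"
    if b: "b \<in> carrier G" and k: "k \<in> lengths G b" and l: "l \<in> lengths G b" for b k l
  proof (rule ccontr)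
    assume "\<not> ?thesis"
    then have "Suc (Suc k * R) * m \<le> l" by linarith
    then obtain c where "c \<in> carrier G" "b = u [^] Suc (Suc k * R) \<otimes> c"
      using lengths_ge_pow_divides[OF u b l] unfolding m_def by blast
    then have "Suc (Suc k * R) \<le> Suc k * R"
      using pow_exponent_bounded[OF u, of R c k "Suc (Suc k * R)"] R k by (auto simp: m_def)
    then show False by simp
  qed
  fix x assume x: "x \<in> atoms G"
  then have xc: "x \<in> carrier G" by (rule atoms_closed)
  let ?n = "primary_exponent G x"
  have "\<exists>l\<in>lengths G c. l \<le> Suc (Suc ?n * R) * m"
    if c: "c \<in> carrier G" and k: "k \<in> lengths G (x \<otimes> c)" "k \<le> ?n" for c k
  proof -
    obtain l where l: "l \<in> lengths G c" using lengths_nonempty[OF c] by blast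
    then have "1 + l \<in> lengths G (x \<otimes> c)" using lengths_mult[OF xc c lengths_atom[OF x]] by blast
    then have "1 + l < Suc (Suc k * R) * m" using bound[of "x \<otimes> c" k] xc c k by simp
    also have "\<dots> \<le> Suc (Suc ?n * R) * m" using k by (intro mult_le_mono1 Suc_le_mono[THEN iffD2]) simp
    finally show ?thesis using l by (intro bexI[of _ l]) auto
  qed
  then show "\<exists>B. \<forall>c\<in>carrier G. \<forall>k\<in>lengths G (x \<otimes> c). k \<le> ?n \<longrightarrow> (\<exists>l\<in>lengths G c. l \<le> B)"
    by blast
qed

end

section \<open>Consequences of local tameness\<close>

text \<open>Amounts to all distances of \<open>S\<close> being at most \<open>N\<close>. No
  consecutive elements are mentioned: any larger element within reach will do, which makes the
  property easy to carry from one set to another.\<close>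

definition gaps_le :: "nat \<Rightarrow> nat set \<Rightarrow> bool" where
  "gaps_le N S \<longleftrightarrow> (\<forall>k\<in>S. \<forall>l\<in>S. k < l \<longrightarrow> (\<exists>k'\<in>S. k < k' \<and> k' \<le> k + N))"

lemma gaps_leD:
  "gaps_le N S \<Longrightarrow> k \<in> S \<Longrightarrow> l \<in> S \<Longrightarrow> k < l \<Longrightarrow> \<exists>k'\<in>S. k < k' \<and> k' \<le> k + N"
  unfolding gaps_le_def by blast

text \<open>The point \<open>x\<close> need not belong to \<open>S\<close>. The largest element of
  \<open>S\<close> up to \<open>x\<close> has a larger element within \<open>N\<close>, and that one
  must lie beyond \<open>x\<close>.\<close>

lemma gaps_leE:
  assumes S: "gaps_le N S" "p \<in> S" "q \<in> S" and x: "p \<le> x" "x < q"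
  obtains y y' where "y \<in> S" "y' \<in> S" "y \<le> x" "x < y'" "y' \<le> y + N"
proof -
  define y where "y = Max (S \<inter> {..x})"
  have y: "y \<in> S \<inter> {..x}" unfolding y_def using S x by (intro Max_in) auto
  have ym: "k \<le> y" if "k \<in> S" "k \<le> x" for k unfolding y_def using that by (intro Max_ge) auto
  obtain y' where y': "y' \<in> S" "y < y'" "y' \<le> y + N"
    using gaps_leD[OF S(1) _ S(3), of y] x y by auto
  then have "x < y'" using ym[of y'] by force
  then show thesis using that y y' by blast
qed

text \<open>Meant for the sets of lengths \<open>S\<close> of \<open>c\<close> and \<open>L\<close>
  of \<open>x \<otimes> c\<close>. The same \<open>N\<close> serves for both sets, so the transfer
  can be repeated any number of times without loss.\<close>

lemma gaps_leI_near:
  assumes S: "gaps_le N S" "(+) s ` S \<subseteq> L"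
    and near: "\<And>k. k \<in> L \<Longrightarrow> \<exists>l\<in>S. k \<le> s + l + N \<and> s + l \<le> k + N"
  shows "gaps_le N L"
  unfolding gaps_le_def
proof (intro ballI impI)
  fix k l assume k: "k \<in> L" "l \<in> L" "k < l"
  obtain p where p: "p \<in> S" "k \<le> s + p + N" "s + p \<le> k + N" using near[OF k(1)] by blast
  obtain q where q: "q \<in> S" "l \<le> s + q + N" "s + q \<le> l + N" using near[OF k(2)] by blast
  have pL: "s + p \<in> L" using p S by auto
  show "\<exists>k'\<in>L. k < k' \<and> k' \<le> k + N"
  \<comment> \<open>If \<open>k < s + p\<close>, then \<open>s + p\<close> is a larger element
    within reach. If \<open>s + q \<le> k\<close>, then \<open>l\<close> is, being at most
    \<open>s + q + N\<close>. Otherwise \<open>k\<close> lies between two elements of the translate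
    of \<open>S\<close>, whose gaps are bounded.\<close>
  proof (cases "k < s + p \<or> s + q \<le> k")
    case True
    then show ?thesis using p q k pL by (metis add_le_cancel_right le_trans)
  next
    case False
    then have "p \<le> k - s" "k - s < q" by auto
    then obtain y y' where "y \<in> S" "y' \<in> S" "y \<le> k - s" "k - s < y'" "y' \<le> y + N"
      by (rule gaps_leE[OF S(1) p(1) q(1)])
    then show ?thesis using S(2) False by (intro bexI[of _ "s + y'"]) auto
  qed
qed

lemma distances_le:
  assumes "gaps_le N L" "d \<in> distances L"
  shows "d \<le> N"
proof -
  obtain a b where ab: "a \<in> L" "b \<in> L" "b = a + d" "d \<ge> 1" "{a..b} \<inter> L = {a, b}"
    using assms(2) by (auto simp: distances_def)
  then obtain k where k: "k \<in> L" "a < k" "k \<le> a + N"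
    using gaps_leD[OF assms(1) ab(1,2)] by auto
  show ?thesis
  proof (rule ccontr)
    assume "\<not> d \<le> N"
    then have "k \<in> {a..b} \<inter> L" "k \<noteq> a" "k \<noteq> b" using k ab by auto
    then show False using ab by blast
  qed
qed

lemma exists_distance_le:
  assumes "k \<in> L" "l \<in> L" "k < l"
  shows "\<exists>d\<in>distances L. d \<le> l - (k::nat)"
proof -
  define k' where "k' = Inf (L \<inter> {k<..})"
  have m: "l \<in> L \<inter> {k<..}" using assms by simp
  note k' = Inf_nat_mem_le[OF m, folded k'_def]
  have least: "k' \<le> x" if "x \<in> L" "k < x" for x
    unfolding k'_def using that by (intro Inf_nat_mem_le(2)) auto
  have "{k..k'} \<inter> L = {k, k'}"
  proof (intro subset_antisym subsetI)
    fix x assume "x \<in> {k..k'} \<inter> L"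
    then show "x \<in> {k, k'}" using least[of x] by force
  qed (use k' assms(1) in auto)
  moreover have "k' = k + (k' - k)" "k' - k \<ge> 1" "k' \<in> L" using k' by auto
  ultimately have "k' - k \<in> distances L"
    unfolding distances_def using assms(1) by blast
  then show ?thesis using k' by (intro bexI[of _ "k' - k"]) auto
qed

text \<open>For the period consisting of 0 and \<open>d\<close>, the set \<open>P\<close> in
  \<open>AAMP\<close> is just the set of multiples of \<open>d\<close>. The central part is then a
  progression without holes from \<open>s\<close> to \<open>t\<close>, and the outer parts are
  whatever lies below \<open>s\<close> or above \<open>t\<close>.\<close>

lemma AAMP_of_central_progression:
  fixes d M :: nat and s t :: int
  assumes d: "d \<ge> 1" and st: "s \<le> t" "int d dvd t - s"
    and cong: "\<And>x. x \<in> L \<Longrightarrow> int d dvd x - s"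
    and prog: "\<And>x. s \<le> x \<Longrightarrow> x \<le> t \<Longrightarrow> int d dvd x - s \<Longrightarrow> x \<in> L"
    and bound: "L \<subseteq> {s - int M..t + int M}"
  shows "AAMP (int d) {0, int d} M L"
proof -
  define P where "P = {x + int d * k | x k. x \<in> {0, int d}}"
  have P: "P = {z. int d dvd z}"
  proof -
    have "int d * k = 0 + int d * k" for k by simp
    then have "int d * k \<in> P" for k unfolding P_def by blast
    moreover have "int d dvd z" if "z \<in> P" for z using that by (auto simp: P_def)
    ultimately show ?thesis by (auto elim!: dvdE)
  qed
  define Ls where "Ls = P \<inter> {0..t - s}"
  define L' where "L' = (\<lambda>x. x - s) ` (L \<inter> {..<s})"
  define L'' where "L'' = (\<lambda>x. x - s) ` (L \<inter> {t<..})"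
  have fin: "finite Ls" by (simp add: Ls_def)
  have mem: "0 \<in> Ls" "t - s \<in> Ls" using st by (auto simp: Ls_def P)
  have mm: "Min Ls = 0" "Max Ls = t - s"
    using fin mem by (auto intro!: Min_eqI Max_eqI simp: Ls_def)
  have "L = (+) s ` (L' \<union> Ls \<union> L'')"
  proof (intro subset_antisym subsetI)
    fix x assume x: "x \<in> L"
    consider "x < s" | "s \<le> x" "x \<le> t" | "t < x" by linarith
    then have "x - s \<in> L' \<union> Ls \<union> L''"
      by cases (use x cong[OF x] in \<open>auto simp: L'_def L''_def Ls_def P\<close>)
    then show "x \<in> (+) s ` (L' \<union> Ls \<union> L'')" by (force simp: image_iff)
  next
    fix x assume "x \<in> (+) s ` (L' \<union> Ls \<union> L'')"
    then show "x \<in> L" using prog by (auto simp: L'_def L''_def Ls_def P)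
  qed
  moreover have "L \<subseteq> (+) s ` P"
  proof
    fix x assume "x \<in> L"
    then have "x - s \<in> P" using cong by (simp add: P)
    then show "x \<in> (+) s ` P" by (force simp: image_iff)
  qed
  moreover have "L' \<subseteq> {- int M..- 1}" "L'' \<subseteq> {Max Ls + 1..Max Ls + int M}"
    using bound by (auto simp: L'_def L''_def mm)
  moreover have "Ls = P \<inter> {0..Max Ls}" unfolding mm by (simp only: Ls_def)
  ultimately have "\<exists>y L' Ls L''. L = (+) y ` (L' \<union> Ls \<union> L'') \<and> L \<subseteq> (+) y ` P \<and>
      finite Ls \<and> Ls \<noteq> {} \<and> Min Ls = 0 \<and> Ls = P \<inter> {0..Max Ls} \<and>
      L' \<subseteq> {- int M..- 1} \<and> L'' \<subseteq> {Max Ls + 1..Max Ls + int M}"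
    using fin mem mm by blast
  then show ?thesis using d unfolding AAMP_def Let_def P_def by auto
qed

context strongly_primary_monoid
begin

text \<open>The form in which tameness is used. A factorization of \<open>x \<otimes> c\<close> is
  close to one containing \<open>x\<close>; by cancellation the other atoms of the latter form a
  factorization of \<open>c\<close>, and the distance bounds the difference of the sizes.\<close>

lemma locally_tame_atom:
  assumes tame: "locally_tame G" and x: "x \<in> atoms G"
  shows "\<exists>T. \<forall>c\<in>carrier G. \<forall>k\<in>lengths G (x \<otimes> c).
    \<exists>l\<in>lengths G c. k \<le> 1 + l + T \<and> 1 + l \<le> k + T"
proof -
  let ?u = "unit_class x"
  have xc: "x \<in> carrier G" using x by (rule atoms_closed)
  have "tame_degree G ?u < \<infinity>" using tame x by (auto simp: locally_tame_def atoms_reduced)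
  then obtain T where T: "\<And>a z. a \<in> carrier G \<Longrightarrow> fact_of G a \<inter> fact_mult G ?u \<noteq> {} \<Longrightarrow>
      z \<in> fact_of G a \<Longrightarrow> \<exists>z'\<in>fact_of G a \<inter> fact_mult G ?u. fact_dist z z' \<le> T"
    unfolding tame_degree_finite_iff by blast
  have "\<exists>l\<in>lengths G c. k \<le> 1 + l + T \<and> 1 + l \<le> k + T"
    if c: "c \<in> carrier G" and k: "k \<in> lengths G (x \<otimes> c)" for c k
  proof -
    have xcc: "x \<otimes> c \<in> carrier G" using xc c by simp
    obtain z where z: "z \<in> fact_of G (x \<otimes> c)" "size z = k"
      using k xcc by (auto simp: lengths_eq_size_fact_of)
    obtain w where w: "w \<in> fact_of G c"
      using lengths_nonempty[OF c] c by (auto simp: lengths_eq_size_fact_of)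
    then have "{#?u#} + w \<in> fact_of G (x \<otimes> c) \<inter> fact_mult G ?u"
      using fact_of_union[OF xc c fact_of_atom[OF x] w] by (auto simp: fact_mult_def fact_of_def)
    then obtain z' where z': "z' \<in> fact_of G (x \<otimes> c)" "z' \<in> fact_mult G ?u" "fact_dist z z' \<le> T"
      using T[OF xcc _ z(1)] by blast
    then obtain y where y: "z' = {#?u#} + y" by (auto simp: fact_mult_def)
    obtain c' where c': "c' \<in> carrier G" "y \<in> fact_of G c'" "x \<otimes> c = x \<otimes> c'"
      using fact_of_unionE[OF xcc xc fact_of_atom[OF x], of y] z'(1) y by blast
    then have "c' = c" using xc c l_cancel by metis
    then have "size y \<in> lengths G c" using c' c by (auto simp: lengths_eq_size_fact_of)
    moreover have "k \<le> 1 + size y + T" "1 + size y \<le> k + T"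
      using size_le_fact_dist[where z = z and z' = z'] z'(3) z(2) y by auto
    ultimately show ?thesis by blast
  qed
  then show ?thesis by blast
qed

text \<open>Remove the atoms of a factorization of \<open>a\<close> of length \<open>m\<close> one
  at a time; the constants for the single atoms add up.\<close>

lemma locally_tame_lengths:
  assumes tame: "locally_tame G" and a: "a \<in> carrier G" "m \<in> lengths G a"
  shows "\<exists>T. \<forall>c\<in>carrier G. \<forall>k\<in>lengths G (a \<otimes> c).
    \<exists>l\<in>lengths G c. k \<le> m + l + T \<and> m + l \<le> k + T"
  using a
proof (induction m arbitrary: a)
  case 0
  then have "a \<in> Units G" by (simp add: zero_in_lengths_iff)
  then show ?case by (intro exI[of _ 0]) (auto simp: lengths_unit_mult)
next
  case (Suc m)
  have "1 + m \<in> lengths G a" using Suc.prems by simp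
  with Suc.prems(1) obtain x b where b: "x \<in> carrier G" "b \<in> carrier G" "a = x \<otimes> b"
    "1 \<in> lengths G x" "m \<in> lengths G b"
    by (rule lengths_splitE)
  obtain T1 where T1: "\<And>c k. c \<in> carrier G \<Longrightarrow> k \<in> lengths G (x \<otimes> c) \<Longrightarrow>
      \<exists>l\<in>lengths G c. k \<le> 1 + l + T1 \<and> 1 + l \<le> k + T1"
    using locally_tame_atom[OF tame length_one_atom[OF b(1,4)]] by blast
  obtain T2 where T2: "\<And>c k. c \<in> carrier G \<Longrightarrow> k \<in> lengths G (b \<otimes> c) \<Longrightarrow>
      \<exists>l\<in>lengths G c. k \<le> m + l + T2 \<and> m + l \<le> k + T2"
    using Suc.IH[OF b(2,5)] by blast
  have "\<exists>l\<in>lengths G c. k \<le> Suc m + l + (T1 + T2) \<and> Suc m + l \<le> k + (T1 + T2)"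
    if c: "c \<in> carrier G" and k: "k \<in> lengths G (a \<otimes> c)" for c k
  proof -
    have "k \<in> lengths G (x \<otimes> (b \<otimes> c))" using k b c by (simp add: m_assoc)
    then obtain k' where k': "k' \<in> lengths G (b \<otimes> c)" "k \<le> 1 + k' + T1" "1 + k' \<le> k + T1"
      using T1[of "b \<otimes> c" k] b c by auto
    then obtain l where "l \<in> lengths G c" "k' \<le> m + l + T2" "m + l \<le> k' + T2"
      using T2[OF c] by blast
    then show ?thesis using k' by (intro bexI[of _ l]) auto
  qed
  then show ?case by blast
qed

lemma locally_tame_gaps:
  assumes tame: "locally_tame G"
  shows "\<exists>N. \<forall>b\<in>carrier G. gaps_le N (lengths G b)"
proof -
  obtain x where x: "x \<in> atoms G" by (rule atom_obtain)
  have xc: "x \<in> carrier G" and xn: "x \<in> nonunits G"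
    using x by (auto simp: atoms_def nonunits_def irreducible_def)
  obtain T where T: "\<And>c k. c \<in> carrier G \<Longrightarrow> k \<in> lengths G (x \<otimes> c) \<Longrightarrow>
      \<exists>l\<in>lengths G c. k \<le> 1 + l + T \<and> 1 + l \<le> k + T"
    using locally_tame_atom[OF tame x] by blast
  \<comment> \<open>The exponent covers elements all of whose lengths are at most that exponent;
    \<open>T\<close> is the error made when one \<open>x\<close> is split off. As
    \<open>gaps_leI_near\<close> preserves \<open>N\<close>, the number of splittings does not
    matter.\<close>
  define N where "N = max T (primary_exponent G x)"
  have "gaps_le N (lengths G b)" if "b \<in> carrier G" for b
    using that
  proof (induction "Max (lengths G b)" arbitrary: b rule: less_induct)
    case less
    show ?case
    proof (cases "lengths G b \<subseteq> {..primary_exponent G x}")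
      case True
      then show ?thesis by (force simp: gaps_le_def N_def)
    next
      case False
      then obtain c where c: "c \<in> carrier G" "b = x \<otimes> c"
        using lengths_ge_divides[OF xn less.prems] by force
      have "gaps_le N (lengths G c)"
        using less.hyps[of c] Max_lengths_less[OF xn c(1)] c by simp
      moreover have "(+) 1 ` lengths G c \<subseteq> lengths G b"
        using lengths_mult[OF xc c(1) lengths_atom[OF x]] c by auto
      moreover have "\<exists>l\<in>lengths G c. k \<le> 1 + l + N \<and> 1 + l \<le> k + N" if "k \<in> lengths G b" for k
        using T[OF c(1), of k] that c(2) by (force simp: N_def)
      ultimately show ?thesis by (rule gaps_leI_near)
    qed
  qed
  then show ?thesis by blast
qed

section \<open>The minimal distance and the structure of sets of lengths\<close>

lemma Delta_obtain:
  assumes "\<not> half_factorial G"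
  obtains a m where "a \<in> carrier G" "m \<in> lengths G a" "m + Inf (Delta G) \<in> lengths G a"
    "Inf (Delta G) \<ge> 1"
proof -
  obtain b i j where "b \<in> nonunits G" "i \<in> lengths G b" "j \<in> lengths G b" "i < j"
    using not_half_factorial_obtain[OF assms] .
  then obtain d where "d \<in> Delta G"
    using exists_distance_le[of i "lengths G b" j]
    by (auto simp: Delta_def sets_of_lengths_def nonunits_def)
  then have "Inf (Delta G) \<in> Delta G" by (rule Inf_nat_mem_le)
  then show thesis using that by (auto simp: Delta_def sets_of_lengths_def distances_def)
qed

text \<open>If \<open>l - k = q d + r\<close> with \<open>0 < r < d\<close>, then multiplying by the \<open>q\<close>-th power of an element with
  lengths \<open>m\<close> and \<open>m + d\<close> produces two lengths at distance \<open>r\<close>.\<close>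

lemma lengths_congruent:
  assumes nhf: "\<not> half_factorial G" and b: "b \<in> carrier G"
    and k: "k \<in> lengths G b" "l \<in> lengths G b" "k \<le> l"
  shows "Inf (Delta G) dvd l - k"
proof (rule ccontr)
  define d where "d = Inf (Delta G)"
  assume "\<not> ?thesis"
  then have r: "(l - k) mod d \<noteq> 0" by (simp add: d_def mod_eq_0_iff_dvd)
  obtain a m where a: "a \<in> carrier G" "m \<in> lengths G a" "m + d \<in> lengths G a" "d \<ge> 1"
    using Delta_obtain[OF nhf] unfolding d_def .
  define q where "q = (l - k) div d"
  have l: "l = k + q * d + (l - k) mod d" using k(3) by (simp add: q_def)
  let ?c = "a [^] q \<otimes> b"
  have c: "?c \<in> carrier G" using a b by simp
  have "q * (m + d) + k \<in> lengths G ?c" "q * m + l \<in> lengths G ?c"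
    using lengths_mult[OF _ b lengths_nat_pow[OF a(1)]] a b k by auto
  moreover have "q * (m + d) + k < q * m + l" using l r by (simp add: algebra_simps)
  ultimately obtain e where e: "e \<in> distances (lengths G ?c)" "e \<le> q * m + l - (q * (m + d) + k)"
    using exists_distance_le by blast
  then have "e \<in> Delta G" using c by (auto simp: Delta_def sets_of_lengths_def)
  then have "d \<le> e" using Inf_nat_mem_le by (simp add: d_def)
  also have "e \<le> (l - k) mod d" using e(2) l by (simp add: algebra_simps)
  also have "\<dots> < d" using a(4) by simp
  finally show False by simp
qed

lemma finite_Delta:
  assumes "locally_tame G"
  shows "finite (Delta G)"
proof -
  obtain N where "\<And>b. b \<in> carrier G \<Longrightarrow> gaps_le N (lengths G b)"
    using locally_tame_gaps[OF assms] by blast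
  then have "Delta G \<subseteq> {..N}"
    by (auto simp: Delta_def sets_of_lengths_def intro: distances_le)
  then show ?thesis using finite_subset by blast
qed

text \<open>A power \<open>a\<close> of an element with lengths \<open>m\<close> and \<open>m + d\<close> has a progression of lengths so long that
  it fills all the gaps of \<open>lengths G c\<close> in \<open>lengths G (a \<otimes> c)\<close>; tameness keeps the ends short.\<close>

lemma locally_tame_AAMP:
  assumes nhf: "\<not> half_factorial G" and tame: "locally_tame G"
  shows "\<exists>M. \<forall>L\<in>sets_of_lengths G.
    AAMP (int (Inf (Delta G))) {0, int (Inf (Delta G))} M (int ` L)"
proof -
  define d where "d = Inf (Delta G)"
  obtain a0 m0 where a0: "a0 \<in> carrier G" "m0 \<in> lengths G a0" "m0 + d \<in> lengths G a0"
    and d: "d \<ge> 1"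
    using Delta_obtain[OF nhf] unfolding d_def .
  obtain N' where N': "\<And>b. b \<in> carrier G \<Longrightarrow> gaps_le N' (lengths G b)"
    using locally_tame_gaps[OF tame] by blast
  \<comment> \<open>A positive \<open>N\<close> guarantees that \<open>a0 [^] N\<close> has the
    positive length \<open>m + N * d\<close>, so that it is a nonunit.\<close>
  define N where "N = Suc N'"
  have N: "gaps_le N (lengths G b)" if "b \<in> carrier G" for b
    using N'[OF that] by (fastforce simp: gaps_le_def N_def)
  define a where "a = a0 [^] N"
  define m where "m = N * m0"
  have ac: "a \<in> carrier G" using a0 by (simp add: a_def)
  have prog: "m + j * d \<in> lengths G a" if "j \<le> N" for j
    using lengths_pow_progression[OF a0 that] by (simp add: a_def m_def)
  have "m + N * d \<in> lengths G a" "m + N * d \<noteq> 0" using prog[of N] d by (auto simp: N_def)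
  then have "a \<notin> Units G" by (metis lengths_Units singletonD)
  then have an: "a \<in> nonunits G" using ac by (simp add: nonunits_def)
  define n where "n = primary_exponent G a"
  obtain T where T: "\<And>c k. c \<in> carrier G \<Longrightarrow> k \<in> lengths G (a \<otimes> c) \<Longrightarrow>
      \<exists>l\<in>lengths G c. k \<le> m + l + T \<and> m + l \<le> k + T"
    using locally_tame_lengths[OF tame ac, of m] prog[of 0] by auto
  \<comment> \<open>The bound \<open>n\<close> serves for sets contained in the numbers below
    \<open>n\<close>, where a single point is the central progression. In all other cases
    \<open>T\<close> bounds the ends.\<close>
  have "AAMP (int d) {0, int d} (max n T) (int ` L)" if L: "L \<in> sets_of_lengths G" for L
  proof -
    obtain b where b: "b \<in> carrier G" "L = lengths G b" using L by (auto simp: sets_of_lengths_def)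
    have cong: "int d dvd int x - int y" if "x \<in> L" "y \<in> L" for x y
    proof (cases "y \<le> x")
      case True
      then show ?thesis using lengths_congruent[OF nhf b(1), of y x] that b(2)
        by (simp add: d_def flip: of_nat_diff)
    next
      case False
      then have "int d dvd int y - int x" using lengths_congruent[OF nhf b(1), of x y] that b(2)
        by (simp add: d_def flip: of_nat_diff)
      then show ?thesis using dvd_diff_commute by blast
    qed
    show ?thesis
    proof (cases "L \<subseteq> {..<n}")
      case True
      obtain l where l: "l \<in> L" using b lengths_nonempty by blast
      show ?thesis
      proof (rule AAMP_of_central_progression[OF d, of "int l" "int l"])
        show "int ` L \<subseteq> {int l - int (max n T)..int l + int (max n T)}" using True l by force
      qed (use cong l in auto)
    next
      case False
      then obtain c where c: "c \<in> carrier G" "b = a \<otimes> c"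
        using lengths_ge_divides[OF an b(1)] b by (force simp: n_def)
      define p where "p = Min (lengths G c)"
      define q where "q = Max (lengths G c)"
      have p: "p \<in> lengths G c" and q: "q \<in> lengths G c"
        using lengths_nonempty[OF c(1)] finite_lengths[OF c(1)] by (auto simp: p_def q_def)
      have pq: "p \<le> l" "l \<le> q" if "l \<in> lengths G c" for l
        using finite_lengths[OF c(1)] that by (auto simp: p_def q_def)
      have sum: "m + j * d + l \<in> L" if "l \<in> lengths G c" "j \<le> N" for l j
        using lengths_mult[OF ac c(1) prog that(1)] that b c by simp
      have mL: "m + p \<in> L" "m + q \<in> L" using sum[OF p, of 0] sum[OF q, of 0] by auto
      have fill: "x \<in> L" if x: "m + p \<le> x" "x \<le> m + q" "int d dvd int x - int (m + p)" for x
      proof (cases "x = m + q")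
        case True
        then show ?thesis using mL by simp
      next
        case False
        then have "p \<le> x - m" "x - m < q" using x by auto
        then obtain l l' where l: "l \<in> lengths G c" "l \<le> x - m" "x - m < l'" "l' \<le> l + N"
          by (rule gaps_leE[OF N[OF c(1)] p q])
        \<comment> \<open>All lengths are congruent modulo \<open>d\<close>, so \<open>x\<close>
          exceeds \<open>m + l\<close> by some \<open>j * d\<close>. This excess is at most
          \<open>N\<close>, whence \<open>j \<le> N\<close>, and the length \<open>m + j * d\<close>
          of \<open>a\<close> together with \<open>l\<close> reaches \<open>x\<close>.\<close>
        have "int d dvd int (m + l) - int (m + p)" using cong[OF sum[OF l(1), of 0] mL(1)] by simp
        then have "int d dvd (int x - int (m + p)) - (int (m + l) - int (m + p))"
          by (rule dvd_diff[OF x(3)])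
        moreover have "int (x - (m + l)) = (int x - int (m + p)) - (int (m + l) - int (m + p))"
          using l x by (simp add: of_nat_diff)
        ultimately have "int d dvd int (x - (m + l))" by (simp only:)
        then have "d dvd x - (m + l)" by (simp only: int_dvd_int_iff)
        then obtain j where j: "x - (m + l) = d * j" by (rule dvdE)
        then have "x = m + j * d + l" using l x by (simp add: mult.commute)
        moreover have "j \<le> d * j" using d by simp
        then have "j \<le> N" using j l x by linarith
        ultimately show ?thesis using sum l by blast
      qed
      show ?thesis
      proof (rule AAMP_of_central_progression[OF d, of "int (m + p)" "int (m + q)"])
        show "int (m + p) \<le> int (m + q)" using pq p by simp
        show "int d dvd int (m + q) - int (m + p)" using cong mL by blast
        show "int d dvd x - int (m + p)" if "x \<in> int ` L" for x using cong mL that by blast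
        show "x \<in> int ` L" if x: "int (m + p) \<le> x" "x \<le> int (m + q)" "int d dvd x - int (m + p)" for x
        proof -
          have "x = int (nat x)" using x by simp
          then show ?thesis using fill[of "nat x"] x by (metis imageI of_nat_le_iff)
        qed
        show "int ` L \<subseteq> {int (m + p) - int (max n T)..int (m + q) + int (max n T)}"
        proof
          fix x assume "x \<in> int ` L"
          then obtain k where k: "x = int k" "k \<in> lengths G (a \<otimes> c)" using b c by blast
          then obtain l where "l \<in> lengths G c" "k \<le> m + l + T" "m + l \<le> k + T"
            using T[OF c(1)] by blast
          then show "x \<in> {int (m + p) - int (max n T)..int (m + q) + int (max n T)}"
            using pq[of l] k(1) by auto
        qed
      qed
    qed
  qed
  then show ?thesis unfolding d_def by blast
qed

end

section \<open>Zero-sum sequences\<close>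

text \<open>Lifting gives one inclusion. The other needs images of atoms to be atoms, which the
  definition does not demand: a factorization of \<open>\<theta> x\<close> lifts to one of
  \<open>x\<close> with equally many atoms, so for an atom \<open>x\<close> it consists of a single
  atom.\<close>

lemma weak_transfer_hom_lengths:
  assumes H: "comm_monoid_cancel H" and B: "comm_monoid_cancel B" "Units B = {\<one>\<^bsub>B\<^esub>}" "atomic_monoid B"
    and \<theta>: "weak_transfer_hom H B \<theta>" and a: "a \<in> carrier H"
  shows "lengths H a = lengths B (\<theta> a)"
proof -
  interpret H: comm_monoid_cancel H by fact
  interpret B: comm_monoid_cancel B by fact
  have hom: "\<theta> \<in> hom H B" and one: "\<theta> \<one>\<^bsub>H\<^esub> = \<one>\<^bsub>B\<^esub>"
    and units: "\<And>x. x \<in> carrier H \<Longrightarrow> \<theta> x = \<one>\<^bsub>B\<^esub> \<longleftrightarrow> x \<in> Units H"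
    using \<theta> by (auto simp: weak_transfer_hom_def)
  have lift: "\<exists>us. length us = length vs \<and> set us \<subseteq> carrier H \<and> factors H us x"
    if "x \<in> carrier H" "vs \<noteq> []" "set vs \<subseteq> carrier B" "factors B vs (\<theta> x)" for x vs
    using \<theta> that unfolding weak_transfer_hom_def by blast
  have closed: "\<theta> x \<in> carrier B" if "x \<in> carrier H" for x
    using hom that by (auto simp: hom_def)
  show ?thesis
  proof (cases "a \<in> Units H")
    case True
    then have "\<theta> a \<in> Units B" using units a B(2) by simp
    then show ?thesis using True by (simp add: H.lengths_Units B.lengths_Units)
  next
    case False
    then have nu: "\<theta> a \<notin> Units B" using units a B(2) by simp
    have atom: "irreducible B (\<theta> x)" if x: "x \<in> carrier H" "irreducible H x" for x
    proof -
      have "x \<notin> Units H" using x by (simp add: irreducible_def)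
      then have "\<theta> x \<in> nonunits B" using units closed x(1) B(2) by (simp add: nonunits_def)
      moreover then obtain vs where vs: "set vs \<subseteq> carrier B" "factors B vs (\<theta> x)"
        using B(3) by (auto simp: atomic_monoid_def)
      ultimately have ne: "vs \<noteq> []" using B(2) by (auto simp: factors_def nonunits_def)
      obtain us where us: "length us = length vs" "set us \<subseteq> carrier H" "factors H us x"
        using lift[OF x(1) ne vs] by blast
      then obtain y ys where y: "us = y # ys" using ne by (cases us) auto
      have "x = y \<otimes>\<^bsub>H\<^esub> H.mprod ys" using us y by (auto simp: factors_def)
      moreover have "y \<notin> Units H" using us y by (auto simp: factors_def irreducible_def)
      ultimately have "H.mprod ys \<in> Units H"
        using H.irreducible_prodE[of y "H.mprod ys"] x us y by auto
      then have "set ys \<subseteq> Units H" using H.Units_mprodD us y by auto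
      then have "ys = []" using us y by (cases ys) (auto simp: factors_def irreducible_def)
      then obtain v where "vs = [v]" using us y by (cases vs) auto
      then show ?thesis using vs by (auto simp: factors_def)
    qed
    show ?thesis
    proof (intro subset_antisym subsetI)
      fix k assume "k \<in> lengths H a"
      then obtain us where us: "k = length us" "us \<noteq> []" "set us \<subseteq> carrier H" "factors H us a"
        using False by (auto simp: lengths_def)
      have "\<theta> (H.mprod us) = B.mprod (map \<theta> us)"
        using us(3) by (induction us) (auto simp: one hom_mult[OF hom])
      then have "factors B (map \<theta> us) (\<theta> a)"
        using us atom by (auto simp: factors_def)
      moreover have "set (map \<theta> us) \<subseteq> carrier B" using us closed by auto
      ultimately show "k \<in> lengths B (\<theta> a)"
        using nu us unfolding lengths_def by (auto intro!: exI[of _ "map \<theta> us"])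
    next
      fix k assume "k \<in> lengths B (\<theta> a)"
      then obtain vs where vs: "k = length vs" "vs \<noteq> []" "set vs \<subseteq> carrier B" "factors B vs (\<theta> a)"
        using nu by (auto simp: lengths_def)
      then obtain us where "length us = length vs" "set us \<subseteq> carrier H" "factors H us a"
        using lift[OF a] by blast
      then show "k \<in> lengths H a"
        using False vs unfolding lengths_def by (auto intro!: exI[of _ us])
    qed
  qed
qed

lemma weak_transfer_hom_sets_of_lengths:
  assumes "comm_monoid_cancel H" "comm_monoid_cancel B" "Units B = {\<one>\<^bsub>B\<^esub>}" "atomic_monoid B"
    and \<theta>: "weak_transfer_hom H B \<theta>"
  shows "sets_of_lengths H = sets_of_lengths B"
proof -
  have "lengths H ` carrier H = lengths B ` \<theta> ` carrier H"
    using weak_transfer_hom_lengths[OF assms] by (simp add: image_image)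
  moreover have "\<theta> ` carrier H = carrier B" using \<theta> by (simp add: weak_transfer_hom_def)
  ultimately show ?thesis by (simp add: sets_of_lengths_def)
qed

section \<open>Zero-sum sequences over \<open>G0\<close> and their atoms of minimal support\<close>

locale zero_sum_sequences = comm_group +
  fixes G0 assumes subset: "G0 \<subseteq> carrier G"
begin

abbreviation "B \<equiv> zero_sum_monoid G G0"

lemma mem_carrier: "S \<in> carrier B \<longleftrightarrow> set_mset S \<subseteq> G0 \<and> mset_prod G S = \<one>"
  by (simp add: zero_sum_monoid_def)

lemma mult_B [simp]: "S \<otimes>\<^bsub>B\<^esub> T = S + T" and one_B [simp]: "\<one>\<^bsub>B\<^esub> = {#}"
  by (simp_all add: zero_sum_monoid_def)

lemma empty_closed: "{#} \<in> carrier B"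
  by (simp add: mem_carrier mset_prod_def)

lemma mset_prod_closed: "set_mset S \<subseteq> G0 \<Longrightarrow> mset_prod G S \<in> carrier G"
  unfolding mset_prod_def using subset by (intro finprod_closed) auto

lemma mset_prod_add:
  "set_mset S \<subseteq> G0 \<Longrightarrow> set_mset T \<subseteq> G0 \<Longrightarrow>
    mset_prod G (S + T) = mset_prod G S \<otimes> mset_prod G T"
  using subset by (intro mset_prod_union comm_monoid_axioms) auto

lemma add_closed: "S \<in> carrier B \<Longrightarrow> T \<in> carrier B \<Longrightarrow> S + T \<in> carrier B"
  by (auto simp: mem_carrier mset_prod_add)

text \<open>Removing terms whose product is \<open>\<one>\<close> does not change the product.
  Divisibility in \<open>B\<close> is therefore inclusion of multisets.\<close>

lemma diff_closed:
  assumes "S \<in> carrier B" "T \<in> carrier B" "S \<subseteq># T"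
  shows "T - S \<in> carrier B"
proof -
  have s: "set_mset (T - S) \<subseteq> G0" "set_mset S \<subseteq> G0" using assms in_diffD by (fastforce simp: mem_carrier)+
  have "\<one> = mset_prod G (S + (T - S))" using assms by (simp add: mem_carrier)
  also have "\<dots> = mset_prod G (T - S)"
    using mset_prod_add[OF s(2,1)] mset_prod_closed[OF s(1)] assms(1) by (simp add: mem_carrier)
  finally show ?thesis using s by (simp add: mem_carrier)
qed

lemma repeat_closed: "S \<in> carrier B \<Longrightarrow> repeat_mset n S \<in> carrier B"
  by (induction n) (auto simp: empty_closed add_closed)

lemma comm_monoid_cancel_B: "comm_monoid_cancel B"
  by (intro comm_monoid_cancelI comm_monoidI) (auto simp: add_closed empty_closed ac_simps)

sublocale B: comm_monoid_cancel B
  by (rule comm_monoid_cancel_B)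

lemma Units_B: "Units B = {{#}}"
  by (auto simp: Units_def empty_closed)

lemma atomic_B: "atomic_monoid B"
  unfolding atomic_monoid_def
proof
  fix S assume "S \<in> nonunits B"
  then show "\<exists>xs. set xs \<subseteq> carrier B \<and> factors B xs S"
  proof (induction "size S" arbitrary: S rule: less_induct)
    case less
    show ?case
    proof (cases "S \<in> atoms B")
      case True
      then show ?thesis
        by (intro exI[of _ "[S]"]) (auto simp: factors_def atoms_def)
    next
      case False
      then obtain u v where uv: "u \<in> carrier B" "v \<in> carrier B" "S = u + v"
        "u \<notin> Units B" "v \<notin> Units B"
        using atoms_iff[OF comm_monoid_cancel_B, of S] less.prems by auto
      then have "size u < size S" "size v < size S" by (auto simp: Units_B nonempty_has_size)
      then obtain xs ys where "set xs \<subseteq> carrier B" "factors B xs u" "set ys \<subseteq> carrier B" "factors B ys v"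
        using less.hyps[of u] less.hyps[of v] uv by (auto simp: nonunits_def)
      then have "set (xs @ ys) \<subseteq> carrier B" "factors B (xs @ ys) S"
        using B.mprod_append[of xs ys] uv by (auto simp: factors_def)
      then show ?thesis by blast
    qed
  qed
qed

text \<open>For zero-sum sequences with the same minimal support, the multiple \<open>q V - p U\<close> that kills the
  element where \<open>count V / count U\<close> is least has smaller support, so it is empty and \<open>q V = p U\<close>.\<close>

lemma minimal_support_le:
  assumes U: "U \<in> carrier B" "U \<noteq> {#}"
    and card: "\<And>V. V \<in> carrier B \<Longrightarrow> V \<noteq> {#} \<Longrightarrow> card (set_mset U) \<le> card (set_mset V)"
    and size: "\<And>V. V \<in> carrier B \<Longrightarrow> V \<noteq> {#} \<Longrightarrow> card (set_mset V) = card (set_mset U) \<Longrightarrow> size U \<le> size V"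
    and V: "V \<in> carrier B" "V \<noteq> {#}" "set_mset V \<subseteq> set_mset U"
  shows "U \<subseteq># V"
proof -
  define f where "f g = real (count V g) / real (count U g)" for g
  have "Min (f ` set_mset U) \<in> f ` set_mset U" using U by (intro Min_in) auto
  then obtain h where h: "h \<in># U" "f h = Min (f ` set_mset U)" by auto
  define p where "p = count V h"
  define q where "q = count U h"
  have q: "q > 0" using h by (simp add: q_def)
  have le: "p * count U g \<le> q * count V g" if "g \<in># U" for g
  proof -
    have "f h \<le> f g" using h(2) that by simp
    moreover have "count U g > 0" using that by simp
    ultimately have "real p * real (count U g) \<le> real q * real (count V g)"
      using q by (simp add: f_def p_def q_def field_simps)
    then show ?thesis by (simp flip: of_nat_mult)
  qed
  have sub: "repeat_mset p U \<subseteq># repeat_mset q V"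
    unfolding subseteq_mset_def by (metis count_repeat_mset le le0 mult_0_right not_in_iff)
  define W where "W = repeat_mset q V - repeat_mset p U"
  have W: "W \<in> carrier B"
    unfolding W_def by (intro diff_closed repeat_closed sub U V)
  have supp: "set_mset W \<subseteq> set_mset U - {h}"
  proof
    fix g assume "g \<in># W"
    then have "count W g > 0" by simp
    then have lt: "p * count U g < q * count V g" by (simp add: W_def)
    have "0 < q * count V g" by (rule le_less_trans[OF le0 lt])
    then have "g \<in># V" by simp
    moreover have "g \<noteq> h" using lt by (auto simp: p_def q_def)
    ultimately show "g \<in> set_mset U - {h}" using V by auto
  qed
  have "W = {#}"
  proof (rule ccontr)
    assume "W \<noteq> {#}"
    then have "card (set_mset U) \<le> card (set_mset W)" using card W by blast
    also have "\<dots> \<le> card (set_mset U - {h})" using supp by (intro card_mono) auto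
    also have "\<dots> < card (set_mset U)" using h by (intro card_Diff1_less) auto
    finally show False by simp
  qed
  then have eq: "repeat_mset q V = repeat_mset p U"
    using sub unfolding W_def by (metis Diff_eq_empty_iff_mset subset_mset.antisym)
  \<comment> \<open>So far \<open>U\<close> and \<open>V\<close> are only proportional. Their
    supports have equal cardinality, so the minimal size of \<open>U\<close> applies; it gives
    \<open>q \<le> p\<close>, and then \<open>q * count V g = p * count U g\<close> yields the
    inclusion.\<close>
  have "card (set_mset V) = card (set_mset U)"
    using card[OF V(1,2)] card_mono[OF finite_set_mset V(3)] by simp
  then have "size U \<le> size V" using size V by blast
  moreover have "q * size V = p * size U" using arg_cong[OF eq, of size] by simp
  ultimately have "q * size U \<le> p * size U" by (metis mult_le_mono2)
  then have qp: "q \<le> p" using U by (simp add: nonempty_has_size)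
  show ?thesis unfolding subseteq_mset_def
  proof
    fix g
    have "q * count U g \<le> p * count U g" using qp by simp
    also have "\<dots> = q * count V g" using arg_cong[OF eq, of "\<lambda>M. count M g"] by simp
    finally show "count U g \<le> count V g" using q by simp
  qed
qed

text \<open>Minimise the cardinality of the support first and the size second. The result is an
  atom: a nonempty factor of it has its support inside that of \<open>U\<close>, hence contains
  \<open>U\<close>, which leaves nothing for the cofactor.\<close>

lemma minimal_support_exists:
  assumes "carrier B \<noteq> {{#}}"
  shows "\<exists>U\<in>atoms B. \<forall>V\<in>carrier B. V \<noteq> {#} \<longrightarrow> set_mset V \<subseteq> set_mset U \<longrightarrow> U \<subseteq># V"
proof -
  let ?Z = "\<lambda>V. V \<in> carrier B \<and> V \<noteq> {#}"
  obtain V0 where "?Z V0" using assms empty_closed by blast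
  then have "\<exists>W. ?Z W \<and> (\<forall>V. ?Z V \<longrightarrow> card (set_mset W) \<le> card (set_mset V))"
    by (rule ex_has_least_nat)
  then obtain W where W: "?Z W" "\<And>V. ?Z V \<Longrightarrow> card (set_mset W) \<le> card (set_mset V)" by blast
  let ?Y = "\<lambda>V. ?Z V \<and> card (set_mset V) = card (set_mset W)"
  have "?Y W" using W by simp
  then have "\<exists>U. ?Y U \<and> (\<forall>V. ?Y V \<longrightarrow> size U \<le> size V)"
    by (rule ex_has_least_nat)
  then obtain U where U: "?Y U" "\<And>V. ?Y V \<Longrightarrow> size U \<le> size V" by blast
  have le: "U \<subseteq># V" if "V \<in> carrier B" "V \<noteq> {#}" "set_mset V \<subseteq> set_mset U" for V
  proof (rule minimal_support_le[OF _ _ _ _ that])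
    show "U \<in> carrier B" "U \<noteq> {#}" using U by auto
    show "card (set_mset U) \<le> card (set_mset V)" if "V \<in> carrier B" "V \<noteq> {#}" for V
      using W(2)[of V] U that by simp
    show "size U \<le> size V" if "V \<in> carrier B" "V \<noteq> {#}" "card (set_mset V) = card (set_mset U)" for V
      using U(2)[of V] U(1) that by simp
  qed
  have "U \<in> atoms B"
    unfolding atoms_iff[OF comm_monoid_cancel_B]
  proof (intro conjI ballI impI)
    show "U \<in> nonunits B" using U by (simp add: nonunits_def Units_B)
    fix u v assume uv: "u \<in> carrier B" "v \<in> carrier B" "U = u \<otimes>\<^bsub>B\<^esub> v"
    show "u \<in> Units B \<or> v \<in> Units B"
    proof (rule ccontr)
      assume "\<not> ?thesis"
      then have ne: "u \<noteq> {#}" "v \<noteq> {#}" by (auto simp: Units_B)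
      then have "U \<subseteq># u" using le[OF uv(1) ne(1)] uv(3) by simp
      then have "size U \<le> size u" by (rule size_mset_mono)
      then show False using uv ne by (simp add: nonempty_has_size)
    qed
  qed
  then show ?thesis using le by blast
qed

lemma mprod_B_mem:
  assumes "x \<in> set xs"
  shows "x \<subseteq># B.mprod xs"
  using assms by (induction xs) (auto intro: subset_mset.add_increasing)

lemma mprod_B_replicate: "B.mprod (replicate k U) = repeat_mset k U"
  by (induction k) auto

lemma singleton_sets_of_lengths:
  assumes "carrier B \<noteq> {{#}}" "k \<ge> 1"
  shows "{k} \<in> sets_of_lengths B"
proof -
  obtain U where U: "U \<in> atoms B" and le: "\<And>V. V \<in> carrier B \<Longrightarrow> V \<noteq> {#} \<Longrightarrow>
      set_mset V \<subseteq> set_mset U \<Longrightarrow> U \<subseteq># V"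
    using minimal_support_exists[OF assms(1)] by blast
  have Uc: "U \<in> carrier B" and ne: "U \<noteq> {#}"
    using U by (auto simp: atoms_def irreducible_def Units_B)
  let ?P = "repeat_mset k U"
  have "size ?P \<noteq> 0" using ne assms(2) by simp
  then have "?P \<noteq> {#}" by (metis size_empty)
  then have P: "?P \<notin> Units B" by (simp add: Units_B)
  have "lengths B ?P = {k}"
  proof (intro subset_antisym subsetI)
    fix l assume "l \<in> lengths B ?P"
    then obtain xs where xs: "l = length xs" "set xs \<subseteq> carrier B" "factors B xs ?P"
      using P by (auto simp: lengths_def)
    have "x = U" if x: "x \<in> set xs" for x
    proof -
      have at: "x \<in> atoms B" using xs x by (auto simp: factors_def atoms_def)
      then have xc: "x \<in> carrier B" and x0: "x \<noteq> {#}"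
        by (auto simp: atoms_def irreducible_def Units_B)
      have "x \<subseteq># ?P" using mprod_B_mem[OF x] xs by (simp add: factors_def)
      then have "set_mset x \<subseteq> set_mset ?P" by (rule set_mset_mono)
      also have "\<dots> \<subseteq> set_mset U" by (auto simp flip: count_greater_zero_iff)
      finally have "set_mset x \<subseteq> set_mset U" .
      then have Ux: "U \<subseteq># x" using le xc x0 by blast
      have "x = U \<otimes>\<^bsub>B\<^esub> (x - U)" using Ux by simp
      then have "x - U \<in> Units B"
        using at diff_closed[OF Uc xc Ux] Uc ne
        unfolding atoms_iff[OF comm_monoid_cancel_B] by (auto simp: Units_B)
      then show ?thesis using Ux
        by (simp add: Units_B Diff_eq_empty_iff_mset subset_mset.antisym)
    qed
    then have "xs = replicate l U" using xs(1) by (simp add: replicate_eqI)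
    then have "repeat_mset l U = ?P" using xs(3) mprod_B_replicate by (simp add: factors_def)
    then have "l * size U = k * size U" by (metis size_repeat_mset)
    then show "l \<in> {k}" using ne by simp
  next
    fix l assume "l \<in> {k}"
    moreover have "factors B (replicate k U) ?P"
      using U mprod_B_replicate by (auto simp: factors_def atoms_def)
    ultimately show "l \<in> lengths B ?P"
      using P Uc assms(2) unfolding lengths_def by (auto intro!: exI[of _ "replicate k U"])
  qed
  then show ?thesis using repeat_closed[OF Uc] by (auto simp: sets_of_lengths_def)
qed

end

theorem theorem5p5:
  fixes H :: "('a, 'b) monoid_scheme"
  assumes "comm_monoid_cancel H"
    and "strongly_primary H"
    and "\<not> half_factorial H"
  shows "(\<exists>\<beta>::rat. \<beta> > 1 \<and>
      (\<forall>L\<in>sets_of_lengths H. rho L \<noteq> 1 \<longrightarrow> rho L \<ge> ereal (of_rat \<beta>)))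
    \<and> ((\<forall>(K :: 'g monoid) G\<^sub>0. comm_group K \<and> G\<^sub>0 \<subseteq> carrier K \<longrightarrow>
          sets_of_lengths H \<noteq> sets_of_lengths (zero_sum_monoid K G\<^sub>0))
       \<and> \<not> transfer_Krull TYPE('g) H)
    \<and> (((SUP c\<in>carrier H. enat (Inf (lengths H c))) < \<infinity>
          \<or> (\<exists>u\<in>nonunits H. rho_k H (primary_exponent H u) < \<infinity>)
        \<longrightarrow> locally_tame H)
       \<and> (locally_tame H \<longrightarrow>
          finite (Delta H) \<and>
          (\<exists>M::nat. \<forall>L\<in>sets_of_lengths H.
             AAMP (int (Inf (Delta H))) {0, int (Inf (Delta H))} M (int ` L))))"
  (is "?rho \<and> ?krull \<and> ?tame")
proof -
  interpret comm_monoid_cancel H by fact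
  interpret strongly_primary_monoid H by unfold_locales fact
  note nhf = assms(3)
  have zero_sum: "sets_of_lengths H \<noteq> sets_of_lengths (zero_sum_monoid K G\<^sub>0)"
    if K: "comm_group K" "G\<^sub>0 \<subseteq> carrier K" for K :: "'g monoid" and G\<^sub>0
  proof
    assume eq: "sets_of_lengths H = sets_of_lengths (zero_sum_monoid K G\<^sub>0)"
    interpret Z: zero_sum_sequences K G\<^sub>0
      by (intro zero_sum_sequences.intro zero_sum_sequences_axioms.intro K)
    obtain n where n: "\<And>k. k \<ge> n \<Longrightarrow> {k} \<notin> sets_of_lengths H"
      using singletons_bounded[OF nhf] by blast
    obtain a where a: "a \<in> nonunits H" by (rule nonunit_obtain)
    show False
    \<comment> \<open>If only the empty sequence has product \<open>\<one>\<close>, there are no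
      atoms and the only set of lengths is that of the unit. But \<open>H\<close> has a nonunit, and
      0 is not among its lengths.\<close>
    proof (cases "carrier Z.B = {{#}}")
      case True
      then have "sets_of_lengths H = {{0}}"
        using eq by (simp add: sets_of_lengths_def Z.B.lengths_Units Z.Units_B)
      then have "lengths H a = {0}" using a by (auto simp: sets_of_lengths_def nonunits_def)
      then show False using a zero_in_lengths_iff[of a] by (simp add: nonunits_def)
    next
      case False
      \<comment> \<open>The successor makes the length positive, as the existence of
        \<open>{k}\<close> is only proved for \<open>k \<ge> 1\<close>.\<close>
      then show False using Z.singleton_sets_of_lengths[of "Suc n"] n[of "Suc n"] eq by simp
    qed
  qed
  have "\<not> transfer_Krull TYPE('g) H"
  proof
    assume "transfer_Krull TYPE('g) H"
    then obtain K :: "'g monoid" and G\<^sub>0 \<theta> where K: "comm_group K" "G\<^sub>0 \<subseteq> carrier K"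
      and \<theta>: "weak_transfer_hom H (zero_sum_monoid K G\<^sub>0) \<theta>"
      by (auto simp: transfer_Krull_def)
    interpret Z: zero_sum_sequences K G\<^sub>0
      by (intro zero_sum_sequences.intro zero_sum_sequences_axioms.intro K)
    have "sets_of_lengths H = sets_of_lengths Z.B"
      using weak_transfer_hom_sets_of_lengths[OF comm_monoid_cancel_axioms Z.comm_monoid_cancel_B _
          Z.atomic_B \<theta>] Z.Units_B by simp
    then show False using zero_sum[OF K] by simp
  qed
  with zero_sum have ?krull by iprover
  moreover have ?tame
  proof (intro conjI impI)
    show "locally_tame H" if "(SUP c\<in>carrier H. enat (Inf (lengths H c))) < \<infinity>
        \<or> (\<exists>u\<in>nonunits H. rho_k H (primary_exponent H u) < \<infinity>)"
      using that locally_tame_of_bounded_min_lengths locally_tame_of_rho_k by (elim disjE bexE)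
  qed (fact finite_Delta locally_tame_AAMP[OF nhf])+
  ultimately have "?krull \<and> ?tame" by (rule conjI)
  with rho_gap[OF nhf] show ?thesis by (rule conjI)
qed

end
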